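(* Let $1\le p,r\le\infty$, let $(T,\Sigma,\mu)$ be a complete $\sigma$-finite measure space, let $Y,Z$ be separable Banach spaces, and let $S:T\rightrightarrows Y\times Z$ be a measurable multifunction with nonempty closed values. If $(x,y)\in\mathsf{Sel}_{p,r}(S)$, then $$\widehat{\mathbf T}_{\mathsf{Sel}_{p,r}(S)}(x,y)\subset\{(u,v)\in L^p(T,Y)\times L^r(T,Z): (u(t),v(t))\in\widehat{\mathbf T}_{S(t)}(x(t),y(t))\ \text{for a.e. }t\in T\}.$$
   Context: $L^p(T,Y)$, $L^r(T,Z)$ are Lebesgue--Bochner spaces; $Y\times Z$ carries the norm $\|\cdot\|_Y+\|\cdot\|_Z$ and $L^p(T,Y)\times L^r(T,Z)$ the norm $\|\cdot\|_{L^p}+\|\cdot\|_{L^r}$. A multifunction $S:T\rightrightarrows Y\times Z$ with nonempty closed values is measurable if $\{t: S(t)\cap U\ne\emptyset\}\in\Sigma$ for every open $U\subset Y\times Z$. $$\mathsf{Sel}_{p,r}(S):=\{(a,b)\in L^p(T,Y)\times L^r(T,Z): (a(t),b(t))\in S(t)\text{ a.e.}\}.$$ Clarke tangent cone: for a Banach space $X$ with closed unit ball $\overline{\mathbf B}_X$, a closed set $C\subset X$ and $x\in C$, $\widehat{\mathbf T}_C(x)$ is the set of all $v\in X$ such that for every $\varepsilon>0$ there exist $\delta>0$, $\lambda>0$ such that $C\cap[y+\eta(v+\varepsilon\overline{\mathbf B}_X)]\ne\emptyset$ for every $y\in C\cap(x+\delta\overline{\mathbf B}_X)$ and every $\eta\in[0,\lambda]$.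 The cone on the left is taken in $L^p(T,Y)\times L^r(T,Z)$; the cones on the right in $Y\times Z$. *)

theory Defs
  imports "HOL-Probability.Essential_Supremum"
begin

section \<open>Normed spaces with explicit operations\<close>

text \<open>
  The space \<open>L\<^sup>p(M)\<close> depends on the term \<open>M\<close>, so it cannot be an instance of a normed-vector-space
  type class. The record lets the tangent cone be defined once, for \<open>L\<^sup>p \<times> L\<^sup>r\<close> and for \<open>Y \<times> Z\<close>.
\<close>

record 'v normed_structure =
  points :: "'v set"
  add :: "'v \<Rightarrow> 'v \<Rightarrow> 'v"
  scale :: "real \<Rightarrow> 'v \<Rightarrow> 'v"
  nrm :: "'v \<Rightarrow> real"

definition type_space :: "'b::real_normed_vector normed_structure" where
  "type_space = \<lparr>points = UNIV, add = (+), scale = (*\<^sub>R), nrm = norm\<rparr>"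

text \<open>The product carries the sum norm, unlike the product type, whose norm is Euclidean. The two
  norms are equivalent, so \<open>open\<close> and \<open>closed\<close> on \<open>'y \<times> 'z\<close> refer to the intended topology.\<close>

definition sum_space ::
    "'v normed_structure \<Rightarrow> 'w normed_structure \<Rightarrow> ('v \<times> 'w) normed_structure" where
  "sum_space E F =
     \<lparr>points = points E \<times> points F,
      add = (\<lambda>a b. (add E (fst a) (fst b), add F (snd a) (snd b))),
      scale = (\<lambda>c a. (scale E c (fst a), scale F c (snd a))),
      nrm = (\<lambda>a. nrm E (fst a) + nrm F (snd a))\<rparr>"

definition closed_unit_ball :: "'v normed_structure \<Rightarrow> 'v set" where
  "closed_unit_ball E = {b \<in> points E. nrm E b \<le> 1}"

text \<open>
  \<open>clarke_cone E C x\<close> is meant for a Banach space \<open>E\<close>, a closed \<open>C \<subseteq> points E\<close> and \<open>x \<in> C\<close>.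
\<close>

definition clarke_cone :: "'v normed_structure \<Rightarrow> 'v set \<Rightarrow> 'v \<Rightarrow> 'v set" where
  "clarke_cone E C x =
     {v \<in> points E. \<forall>\<epsilon>>0. \<exists>\<delta>>0. \<exists>\<tau>>0.
        \<forall>y \<in> C \<inter> (\<lambda>b. add E x (scale E \<delta> b)) ` closed_unit_ball E. \<forall>\<eta> \<in> {0..\<tau>}.
          C \<inter> (\<lambda>b. add E y (scale E \<eta> (add E v (scale E \<epsilon> b)))) ` closed_unit_ball E \<noteq> {}}"


section \<open>Lebesgue--Bochner spaces\<close>

text \<open>For separable \<open>Y\<close>, strong measurability is the same as Borel measurability.\<close>

definition Lp_fun :: "ennreal \<Rightarrow> 'a measure \<Rightarrow>
    ('a \<Rightarrow> 'b::{banach, second_countable_topology}) set" where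
  "Lp_fun p M = {f \<in> borel_measurable M.
     if p = \<infinity> then esssup M (\<lambda>t. ennreal (norm (f t))) < \<infinity>
     else integrable M (\<lambda>t. norm (f t) powr enn2real p)}"

definition Lp_seminorm :: "ennreal \<Rightarrow> 'a measure \<Rightarrow>
    ('a \<Rightarrow> 'b::{banach, second_countable_topology}) \<Rightarrow> real" where
  "Lp_seminorm p M f =
     (if p = \<infinity> then enn2real (esssup M (\<lambda>t. ennreal (norm (f t))))
      else (\<integral>t. norm (f t) powr enn2real p \<partial>M) powr (1 / enn2real p))"

definition Lp_rel :: "ennreal \<Rightarrow> 'a measure \<Rightarrow>
    (('a \<Rightarrow> 'b::{banach, second_countable_topology}) \<times> ('a \<Rightarrow> 'b)) set" where
  "Lp_rel p M = {(f, g). f \<in> Lp_fun p M \<and> g \<in> Lp_fun p M \<and> (AE t in M. f t = g t)}"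

definition Lp_class :: "ennreal \<Rightarrow> 'a measure \<Rightarrow>
    ('a \<Rightarrow> 'b::{banach, second_countable_topology}) \<Rightarrow> ('a \<Rightarrow> 'b) set" where
  "Lp_class p M f = Lp_rel p M `` {f}"

definition Lp_space :: "ennreal \<Rightarrow> 'a measure \<Rightarrow>
    ('a \<Rightarrow> 'b::{banach, second_countable_topology}) set normed_structure" where
  "Lp_space p M =
     \<lparr>points = Lp_fun p M // Lp_rel p M,
      add = (\<lambda>A B. \<Union>f\<in>A. \<Union>g\<in>B. Lp_class p M (\<lambda>t. f t + g t)),
      scale = (\<lambda>c A. \<Union>f\<in>A. Lp_class p M (\<lambda>t. c *\<^sub>R f t)),
      nrm = (\<lambda>A. the_elem (Lp_seminorm p M ` A))\<rparr>"

text \<open>The operations on classes do not depend on the representatives.\<close>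

lemma equiv_Lp_rel: "equiv (Lp_fun p M) (Lp_rel p M)"
  unfolding equiv_def refl_on_def sym_def trans_def Lp_rel_def by auto

lemma Lp_fun_AE_cong:
  assumes "f \<in> Lp_fun p M" "g \<in> borel_measurable M" "AE t in M. f t = g t"
  shows "g \<in> Lp_fun p M"
proof -
  have f [measurable]: "f \<in> borel_measurable M" using assms(1) by (simp add: Lp_fun_def)
  note g [measurable] = assms(2)
  have "esssup M (\<lambda>t. ennreal (norm (f t))) = esssup M (\<lambda>t. ennreal (norm (g t)))"
    by (rule esssup_AE_cong) (use assms(3) in auto)
  moreover have "integrable M (\<lambda>t. norm (f t) powr enn2real p)
      \<longleftrightarrow> integrable M (\<lambda>t. norm (g t) powr enn2real p)"
    by (rule integrable_cong_AE) (use assms(3) in auto)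
  ultimately show ?thesis using assms(1) by (auto simp: Lp_fun_def split: if_splits)
qed

lemma Lp_seminorm_AE_cong:
  assumes [measurable]: "f \<in> borel_measurable M" "g \<in> borel_measurable M"
    and "AE t in M. f t = g t"
  shows "Lp_seminorm p M f = Lp_seminorm p M g"
proof -
  have "esssup M (\<lambda>t. ennreal (norm (f t))) = esssup M (\<lambda>t. ennreal (norm (g t)))"
    by (rule esssup_AE_cong) (use assms(3) in auto)
  moreover have "(\<integral>t. norm (f t) powr enn2real p \<partial>M) = (\<integral>t. norm (g t) powr enn2real p \<partial>M)"
    by (rule integral_cong_AE) (use assms(3) in auto)
  ultimately show ?thesis by (simp add: Lp_seminorm_def)
qed

lemma Lp_class_eq:
  assumes "f \<in> Lp_fun p M"
  shows "Lp_class p M f = {g \<in> borel_measurable M. AE t in M. f t = g t}"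
  using assms Lp_fun_AE_cong[OF assms] by (auto simp: Lp_class_def Lp_rel_def Lp_fun_def)

lemma Lp_class_self: "f \<in> Lp_fun p M \<Longrightarrow> f \<in> Lp_class p M f"
  by (auto simp: Lp_class_def Lp_rel_def)

lemma Lp_class_AE_cong:
  assumes [measurable]: "f \<in> borel_measurable M" "g \<in> borel_measurable M"
    and ae: "AE t in M. f t = g t"
  shows "Lp_class p M f = Lp_class p M g"
proof -
  have ae': "AE t in M. g t = f t" using ae by auto
  have "f \<in> Lp_fun p M \<longleftrightarrow> g \<in> Lp_fun p M"
    using Lp_fun_AE_cong[OF _ assms(2) ae] Lp_fun_AE_cong[OF _ assms(1) ae'] by blast
  then show ?thesis
    using ae by (auto simp: Lp_class_def Lp_rel_def elim: eventually_elim2)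
qed

lemma points_Lp_space: "points (Lp_space p M) = Lp_class p M ` Lp_fun p M"
  by (auto simp: Lp_space_def quotient_def Lp_class_def)

lemma nrm_Lp_class:
  assumes "f \<in> Lp_fun p M"
  shows "nrm (Lp_space p M) (Lp_class p M f) = Lp_seminorm p M f"
proof -
  have f: "f \<in> borel_measurable M" using assms by (simp add: Lp_fun_def)
  have "Lp_seminorm p M ` Lp_class p M f = {Lp_seminorm p M f}"
  proof (intro equalityI subsetI)
    fix c assume "c \<in> Lp_seminorm p M ` Lp_class p M f"
    then obtain g where "g \<in> Lp_class p M f" and c: "c = Lp_seminorm p M g" by blast
    then have "g \<in> borel_measurable M" "AE t in M. f t = g t"
      by (simp_all add: Lp_class_eq[OF assms])
    then show "c \<in> {Lp_seminorm p M f}" using Lp_seminorm_AE_cong[OF f] c by simp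
  qed (use Lp_class_self[OF assms] in blast)
  then show ?thesis by (simp add: Lp_space_def)
qed

lemma add_Lp_class:
  assumes "f \<in> Lp_fun p M" "g \<in> Lp_fun p M"
  shows "add (Lp_space p M) (Lp_class p M f) (Lp_class p M g) = Lp_class p M (\<lambda>t. f t + g t)"
proof -
  have [measurable]: "f \<in> borel_measurable M" "g \<in> borel_measurable M"
    using assms by (simp_all add: Lp_fun_def)
  have "Lp_class p M (\<lambda>t. f' t + g' t) = Lp_class p M (\<lambda>t. f t + g t)"
    if "f' \<in> Lp_class p M f" "g' \<in> Lp_class p M g" for f' g'
  proof -
    have [measurable]: "f' \<in> borel_measurable M" "g' \<in> borel_measurable M"
      and "AE t in M. f t = f' t" "AE t in M. g t = g' t"
      using that assms by (auto simp: Lp_class_eq)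
    then show ?thesis by (intro Lp_class_AE_cong) auto
  qed
  then have "(\<Union>f'\<in>Lp_class p M f. \<Union>g'\<in>Lp_class p M g. Lp_class p M (\<lambda>t. f' t + g' t))
      = Lp_class p M (\<lambda>t. f t + g t)"
    using Lp_class_self[OF assms(1)] Lp_class_self[OF assms(2)] by blast
  then show ?thesis by (simp add: Lp_space_def)
qed

lemma scale_Lp_class:
  assumes "f \<in> Lp_fun p M"
  shows "scale (Lp_space p M) c (Lp_class p M f) = Lp_class p M (\<lambda>t. c *\<^sub>R f t)"
proof -
  have [measurable]: "f \<in> borel_measurable M" using assms by (simp add: Lp_fun_def)
  have "Lp_class p M (\<lambda>t. c *\<^sub>R f' t) = Lp_class p M (\<lambda>t. c *\<^sub>R f t)"
    if "f' \<in> Lp_class p M f" for f'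
  proof -
    have [measurable]: "f' \<in> borel_measurable M" and "AE t in M. f t = f' t"
      using that assms by (auto simp: Lp_class_eq)
    then show ?thesis by (intro Lp_class_AE_cong) auto
  qed
  then have "(\<Union>f'\<in>Lp_class p M f. Lp_class p M (\<lambda>t. c *\<^sub>R f' t))
      = Lp_class p M (\<lambda>t. c *\<^sub>R f t)"
    using Lp_class_self[OF assms] by blast
  then show ?thesis by (simp add: Lp_space_def)
qed


section \<open>Measurable multifunctions and their selections\<close>

definition measurable_multifunction :: "'a measure \<Rightarrow> ('a \<Rightarrow> 'b::topological_space set) \<Rightarrow> bool" where
  "measurable_multifunction M S \<longleftrightarrow>
     (\<forall>U. open U \<longrightarrow> {t \<in> space M. S t \<inter> U \<noteq> {}} \<in> sets M)"

definition Sel :: "ennreal \<Rightarrow> ennreal \<Rightarrow> 'a measure \<Rightarrow>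
    ('a \<Rightarrow> ('y::{banach, second_countable_topology} \<times> 'z::{banach, second_countable_topology}) set) \<Rightarrow>
    (('a \<Rightarrow> 'y) set \<times> ('a \<Rightarrow> 'z) set) set" where
  "Sel p r M S =
     {(Lp_class p M a, Lp_class r M b) | a b.
        a \<in> Lp_fun p M \<and> b \<in> Lp_fun r M \<and> (AE t in M. (a t, b t) \<in> S t)}"

end

theory Submission
  imports Defs
begin

text \<open>
  Suppose \<open>(u, v)\<close> is a Clarke tangent of \<open>Sel\<close>, but on a set \<open>D\<close> of positive finite measure
  \<open>(u(t), v(t))\<close> fails to be one of \<open>S(t)\<close>. A failure at one step length forces failures, from points of
  \<open>S(t)\<close> still near \<open>(x(t), y(t))\<close>, at all sufficiently small step lengths. Hence for small \<open>h\<close> the failure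
  occurs at the common step length \<open>h\<close> on a subset of \<open>D\<close> of measure at least \<open>\<mu>(D) / 2\<close>. A measurable
  selection of the points of failure, extended by \<open>(x, y)\<close>, is an element of \<open>Sel\<close> near \<open>(x, y)\<close> from
  which every element of \<open>Sel\<close> misses the step \<open>h(u, v)\<close> by at least a constant multiple of \<open>h\<close> on that
  subset. As its measure is bounded below independently of \<open>h\<close>, this contradicts the tangency of \<open>(u, v)\<close>.
\<close>

section \<open>Measurable selections\<close>

text \<open>An open set meets the closure of a set exactly when it meets the set itself, so every
  hitting set here is built from hitting sets of \<open>S\<close>. Falling back on
  \<open>S t\<close> where \<open>S t\<close> misses \<open>U\<close> keeps the values
  nonempty.\<close>

lemma measurable_multifunction_restrict_closure:
  fixes S :: "'a \<Rightarrow> 'b::topological_space set"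
  assumes S: "measurable_multifunction M S" and U: "open U"
  shows "measurable_multifunction M (\<lambda>t. if S t \<inter> U = {} then S t else closure (S t \<inter> U))"
  unfolding measurable_multifunction_def
proof (intro allI impI)
  fix V :: "'b set" assume V: "open V"
  have eq: "{t \<in> space M. (if S t \<inter> U = {} then S t else closure (S t \<inter> U)) \<inter> V \<noteq> {}}
    = {t \<in> space M. S t \<inter> (U \<inter> V) \<noteq> {}} \<union> ({t \<in> space M. S t \<inter> V \<noteq> {}} - {t \<in> space M. S t \<inter> U \<noteq> {}})"
    using open_Int_closure_eq_empty[OF V] by (auto simp: Int_ac)
  show "{t \<in> space M. (if S t \<inter> U = {} then S t else closure (S t \<inter> U)) \<inter> V \<noteq> {}} \<in> sets M"
    unfolding eq using S V U by (intro sets.Un sets.Diff) (auto simp: measurable_multifunction_def)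
qed

lemma Cauchy_dist_geometric:
  fixes f :: "nat \<Rightarrow> 'b::metric_space"
  assumes step: "\<And>n. dist (f n) (f (Suc n)) \<le> C / 2 ^ n"
  shows "Cauchy f"
proof (rule metric_CauchyI)
  have C: "0 \<le> C" using order_trans[OF zero_le_dist step[of 0]] by simp
  \<comment> \<open>Subtracting the remaining part of the geometric series makes the induction
    telescope.\<close>
  have tail: "dist (f n) (f (n + k)) \<le> 2 * C / 2 ^ n - 2 * C / 2 ^ (n + k)" for n k
  proof (induction k)
    case (Suc k)
    have "dist (f n) (f (n + Suc k)) \<le> dist (f n) (f (n + k)) + C / 2 ^ (n + k)"
      using dist_triangle[of "f n" "f (n + Suc k)" "f (n + k)"] step[of "n + k"] by simp
    moreover have "C / 2 ^ (n + k) = 2 * C / 2 ^ (n + k) - 2 * C / 2 ^ (n + Suc k)"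
      by (simp add: field_simps)
    ultimately show ?case using Suc by linarith
  qed simp
  fix e :: real assume e: "0 < e"
  have "(\<lambda>n. 4 * C * (1/2) ^ n) \<longlonglongrightarrow> 4 * C * 0"
    by (intro tendsto_mult tendsto_const LIMSEQ_realpow_zero) auto
  then have "eventually (\<lambda>n. 4 * C * (1/2) ^ n < e) sequentially"
    using e by (intro order_tendstoD(2)) auto
  \<comment> \<open>The factor 4 allows for two distances to \<open>f N\<close>, each at most
    \<open>2 * C / 2 ^ N\<close>.\<close>
  then obtain N where N: "4 * C * (1/2) ^ N < e" by (auto simp: eventually_sequentially)
  have near: "dist (f N) (f m) \<le> 2 * C / 2 ^ N" if "m \<ge> N" for m
  proof -
    have "0 \<le> 2 * C / 2 ^ m" using C by simp
    then show ?thesis using tail[of N "m - N"] that by simp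
  qed
  have "dist (f m) (f n) < e" if "m \<ge> N" "n \<ge> N" for m n
  proof -
    have "2 * C / 2 ^ N + 2 * C / 2 ^ N < e" using N by (simp add: power_one_over)
    then show ?thesis
      using near[OF that(1)] near[OF that(2)] dist_triangle3[of "f m" "f n" "f N"] by linarith
  qed
  then show "\<exists>M. \<forall>m\<ge>M. \<forall>n\<ge>M. dist (f m) (f n) < e" by blast
qed

text \<open>Kuratowski--Ryll-Nardzewski: the selection is a uniform limit of functions with countably many
  values, the \<open>n\<close>-th of which stays at distance less than \<open>1 / 2 ^ n\<close> from \<open>S t\<close>.\<close>

lemma measurable_selection_exists:
  fixes S :: "'a \<Rightarrow> 'b::{complete_space, second_countable_topology} set"
  assumes S: "measurable_multifunction M S"
    and ne: "\<And>t. t \<in> space M \<Longrightarrow> S t \<noteq> {}" and cl: "\<And>t. t \<in> space M \<Longrightarrow> closed (S t)"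
  obtains f where "f \<in> borel_measurable M" "\<And>t. t \<in> space M \<Longrightarrow> f t \<in> S t"
proof -
  obtain D :: "'b set" where D: "countable D" "D \<noteq> {}"
    and dense: "\<And>X. open X \<Longrightarrow> X \<noteq> {} \<Longrightarrow> \<exists>d\<in>D. d \<in> X"
    using countable_dense_exists[where 'a='b] by (metis (no_types, lifting) open_UNIV UNIV_I UNIV_not_empty empty_iff)
  define q where "q = from_nat_into D"
  have q: "\<exists>i. q i \<in> X" if "open X" "X \<noteq> {}" for X
    using dense[OF that] D unfolding q_def by (metis from_nat_into_surj)
  \<comment> \<open>Taking the least index keeps \<open>J n\<close> measurable. Each new ball must
    meet \<open>S t\<close> inside the previous ball, so consecutive centres are close to a common
    point of \<open>S t\<close>.\<close>
  define J where "J = rec_nat (\<lambda>t. LEAST i. S t \<inter> ball (q i) 1 \<noteq> {})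
    (\<lambda>n j t. LEAST i. S t \<inter> (ball (q (j t)) (1 / 2 ^ n) \<inter> ball (q i) (1 / 2 ^ Suc n)) \<noteq> {})"
  have J0: "J 0 = (\<lambda>t. LEAST i. S t \<inter> ball (q i) 1 \<noteq> {})"
    and JS: "J (Suc n) = (\<lambda>t. LEAST i. S t \<inter> (ball (q (J n t)) (1 / 2 ^ n) \<inter> ball (q i) (1 / 2 ^ Suc n)) \<noteq> {})" for n
    by (simp_all add: J_def)
  have near: "\<exists>i. z \<in> ball (q i) r" if "r > 0" for z r
    using q[of "ball z r"] that by (auto simp: dist_commute)
  \<comment> \<open>The second conjunct at \<open>n\<close> gives the first at \<open>Suc n\<close>,
    and the first supplies the point of \<open>S t\<close> near which the next index is
    found.\<close>
  have inv: "S t \<inter> ball (q (J n t)) (1 / 2 ^ n) \<noteq> {}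
    \<and> S t \<inter> (ball (q (J n t)) (1 / 2 ^ n) \<inter> ball (q (J (Suc n) t)) (1 / 2 ^ Suc n)) \<noteq> {}"
    if t: "t \<in> space M" for t n
  proof (induction n)
    case 0
    obtain z where z: "z \<in> S t" using ne[OF t] by blast
    obtain i where "z \<in> ball (q i) 1" using near[of 1 z] by auto
    then have "S t \<inter> ball (q i) 1 \<noteq> {}" using z by blast
    then have 1: "S t \<inter> ball (q (J 0 t)) 1 \<noteq> {}"
      unfolding J0 by (rule LeastI)
    then obtain z where z: "z \<in> S t" "z \<in> ball (q (J 0 t)) 1" by blast
    obtain i where "z \<in> ball (q i) (1 / 2 ^ Suc 0)" using near[of "1 / 2 ^ Suc 0" z] by auto
    then have "S t \<inter> (ball (q (J 0 t)) (1 / 2 ^ 0) \<inter> ball (q i) (1 / 2 ^ Suc 0)) \<noteq> {}" using z by auto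
    then have "S t \<inter> (ball (q (J 0 t)) (1 / 2 ^ 0) \<inter> ball (q (J (Suc 0) t)) (1 / 2 ^ Suc 0)) \<noteq> {}"
      unfolding JS[of 0] by (rule LeastI)
    then show ?case using 1 by simp
  next
    case (Suc n)
    then obtain z where z: "z \<in> S t" "z \<in> ball (q (J (Suc n) t)) (1 / 2 ^ Suc n)" by blast
    obtain i where "z \<in> ball (q i) (1 / 2 ^ Suc (Suc n))" using near[of "1 / 2 ^ Suc (Suc n)" z] by auto
    then have "S t \<inter> (ball (q (J (Suc n) t)) (1 / 2 ^ Suc n) \<inter> ball (q i) (1 / 2 ^ Suc (Suc n))) \<noteq> {}"
      using z by auto
    then have "S t \<inter> (ball (q (J (Suc n) t)) (1 / 2 ^ Suc n) \<inter> ball (q (J (Suc (Suc n)) t)) (1 / 2 ^ Suc (Suc n))) \<noteq> {}"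
      unfolding JS[of "Suc n"] by (rule LeastI)
    then show ?case using z by blast
  qed
  have hit: "Measurable.pred M (\<lambda>t. S t \<inter> U \<noteq> {})" if "open U" for U
    using S that by (auto simp: measurable_multifunction_def pred_def)
  have Jm [measurable]: "J n \<in> measurable M (count_space UNIV)" for n
  proof (induction n)
    case 0
    show ?case unfolding J0 by (intro measurable_Least hit) auto
  next
    case (Suc n)
    note Suc [measurable]
    \<comment> \<open>Since \<open>J n\<close> takes countably many values, it suffices to treat
      each constant value \<open>j\<close>; then the set hit by \<open>S t\<close> no longer depends
      on \<open>t\<close>.\<close>
    have "Measurable.pred M (\<lambda>t. S t \<inter> (ball (q (J n t)) (1 / 2 ^ n) \<inter> ball (q i) (1 / 2 ^ Suc n)) \<noteq> {})" for i
      by (rule measurable_compose_countable[where g="J n" and f="\<lambda>j t. S t \<inter> (ball (q j) (1 / 2 ^ n) \<inter> ball (q i) (1 / 2 ^ Suc n)) \<noteq> {}"])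
        (auto intro!: hit)
    then show ?case unfolding JS by (intro measurable_Least)
  qed
  have conv: "convergent (\<lambda>n. q (J n t))" if t: "t \<in> space M" for t
  proof (intro Cauchy_convergent Cauchy_dist_geometric)
    fix n
    obtain z where "dist (q (J n t)) z < 1 / 2 ^ n" "dist (q (J (Suc n) t)) z < 1 / 2 ^ Suc n"
      using inv[OF t, of n] by auto
    moreover have "1 / 2 ^ n + 1 / 2 ^ Suc n \<le> (2 :: real) / 2 ^ n" by (simp add: field_simps)
    ultimately show "dist (q (J n t)) (q (J (Suc n) t)) \<le> 2 / 2 ^ n"
      using dist_triangle2[of "q (J n t)" "q (J (Suc n) t)" z] by linarith
  qed
  define f where "f t = lim (\<lambda>n. q (J n t))" for t
  have lim: "(\<lambda>n. q (J n t)) \<longlonglongrightarrow> f t" if "t \<in> space M" for t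
    using conv[OF that] unfolding f_def by (simp add: convergent_LIMSEQ_iff)
  have "f \<in> borel_measurable M"
    by (rule borel_measurable_LIMSEQ_metric[where f="\<lambda>n t. q (J n t)"]) (auto intro: lim)
  moreover have "f t \<in> S t" if t: "t \<in> space M" for t
  proof -
    \<comment> \<open>Points of \<open>S t\<close> within \<open>1 / 2 ^ n\<close> of the centres
      share their limit \<open>f t\<close>, and \<open>S t\<close> is closed.\<close>
    have "\<forall>n. \<exists>z. z \<in> S t \<and> dist (q (J n t)) z < 1 / 2 ^ n" using inv[OF t] by (auto simp: set_eq_iff)
    then obtain z where z: "\<And>n. z n \<in> S t" "\<And>n. dist (q (J n t)) (z n) < 1 / 2 ^ n" by metis
    have "(\<lambda>n. (1 / 2 :: real) ^ n) \<longlonglongrightarrow> 0" by (intro LIMSEQ_realpow_zero) auto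
    then have "(\<lambda>n. dist (z n) (q (J n t))) \<longlonglongrightarrow> 0"
      by (rule tendsto_sandwich[OF _ _ tendsto_const, rotated 2])
        (use z(2) in \<open>auto intro!: always_eventually less_imp_le simp: dist_commute power_one_over\<close>)
    then have "(\<lambda>n. dist (z n) (q (J n t)) + dist (q (J n t)) (f t)) \<longlonglongrightarrow> 0 + 0"
      using lim[OF t] unfolding tendsto_dist_iff[of "\<lambda>n. q (J n t)"] by (rule tendsto_add)
    then have "(\<lambda>n. dist (z n) (f t)) \<longlonglongrightarrow> 0"
      unfolding add_0_right
      by (rule tendsto_sandwich[OF _ _ tendsto_const, rotated 2])
        (auto intro!: always_eventually dist_triangle)
    then have "z \<longlonglongrightarrow> f t" by (rule iffD2[OF tendsto_dist_iff])
    then show ?thesis using z(1) cl[OF t] closed_sequentially by blast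
  qed
  ultimately show thesis by (rule that)
qed

text \<open>One measurable selection is taken for each basic open set \<open>W i\<close>, with
  values in the closure of \<open>S t \<inter> W i\<close> whenever this intersection is nonempty.
  Basic sets are arbitrarily small around each point of \<open>S t\<close>, which makes the
  selections dense.\<close>

lemma Castaing_representation_exists:
  fixes S :: "'a \<Rightarrow> 'b::{complete_space, second_countable_topology} set"
  assumes S: "measurable_multifunction M S"
    and ne: "\<And>t. t \<in> space M \<Longrightarrow> S t \<noteq> {}" and cl: "\<And>t. t \<in> space M \<Longrightarrow> closed (S t)"
  obtains f :: "nat \<Rightarrow> 'a \<Rightarrow> 'b" where "\<And>i. f i \<in> borel_measurable M"
    "\<And>i t. t \<in> space M \<Longrightarrow> f i t \<in> S t"
    "\<And>t U. t \<in> space M \<Longrightarrow> open U \<Longrightarrow> S t \<inter> U \<noteq> {} \<Longrightarrow> \<exists>i. f i t \<in> U"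
proof -
  obtain B :: "'b set set" where B: "countable B" "topological_basis B"
    using ex_countable_basis by blast
  \<comment> \<open>Inserting \<open>UNIV\<close> makes the enumerated family evidently
    nonempty.\<close>
  define W where "W = from_nat_into (insert UNIV B)"
  have W: "range W = insert UNIV B" unfolding W_def using B(1) by (intro range_from_nat_into) auto
  have Wo: "open (W i)" for i
  proof -
    have "W i \<in> insert UNIV B" using W by blast
    then show ?thesis using topological_basis_open[OF B(2)] by auto
  qed
  define F where "F i t = (if S t \<inter> W i = {} then S t else closure (S t \<inter> W i))" for i t
  have Fsub: "F i t \<subseteq> S t" if "t \<in> space M" for i t
    using cl[OF that] by (auto simp: F_def intro: closure_minimal[THEN subsetD, rotated 2])
  have "\<exists>f. f \<in> borel_measurable M \<and> (\<forall>t\<in>space M. f t \<in> F i t)" for i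
  proof -
    have "measurable_multifunction M (F i)"
      unfolding F_def using S Wo by (rule measurable_multifunction_restrict_closure)
    moreover have "F i t \<noteq> {}" "closed (F i t)" if "t \<in> space M" for t
      using ne[OF that] cl[OF that] by (auto simp: F_def)
    ultimately show ?thesis by (rule measurable_selection_exists) blast+
  qed
  then obtain f where f: "\<And>i. f i \<in> borel_measurable M" "\<And>i t. t \<in> space M \<Longrightarrow> f i t \<in> F i t"
    by metis
  show thesis
  proof (rule that[of f])
    fix t U assume t: "t \<in> space M" and U: "open U" "S t \<inter> U \<noteq> {}"
    then obtain z where z: "z \<in> S t" "z \<in> U" by blast
    \<comment> \<open>The selection is only known to lie in the closure of \<open>V\<close>, so a
      whole closed ball has to fit into \<open>U\<close>.\<close>
    obtain e where e: "e > 0" "cball z e \<subseteq> U" using U z(2) open_contains_cball by blast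
    obtain V where V: "V \<in> B" "z \<in> V" "V \<subseteq> ball z e"
      using topological_basisE[OF B(2) open_ball, of z z e] e(1) by (metis centre_in_ball)
    have "V \<in> range W" using V(1) W by blast
    then obtain i where i: "W i = V" by blast
    have "S t \<inter> V \<noteq> {}" using V(2) z(1) by blast
    then have "f i t \<in> closure (S t \<inter> V)" using f(2)[OF t, of i] by (simp add: F_def i)
    then have "f i t \<in> closure V" using closure_mono[of "S t \<inter> V" V] by blast
    also have "closure V \<subseteq> cball z e"
      using order_trans[OF V(3) ball_subset_cball] closed_cball by (rule closure_minimal)
    finally show "\<exists>i. f i t \<in> U" using e(2) by blast
  next
    show "f i t \<in> S t" if "t \<in> space M" for i t using f(2)[OF that] Fsub[OF that] by blast
  qed (rule f(1))
qed

lemma infdist_less_iff: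
  assumes "A \<noteq> {}"
  shows "infdist x A < r \<longleftrightarrow> (\<exists>a\<in>A. dist x a < r)"
  unfolding infdist_notempty[OF assms]
  by (rule cINF_less_iff[OF assms]) (auto intro: bdd_belowI2[where m=0])

text \<open>By density, the distance to \<open>S t\<close> is below a bound exactly when the
  distance to some member of a Castaing sequence is; this is a countable union of measurable
  conditions.\<close>

lemma borel_measurable_infdist_multifunction:
  fixes S :: "'a \<Rightarrow> 'b::{complete_space, second_countable_topology} set"
  assumes S: "measurable_multifunction M S"
    and ne: "\<And>t. t \<in> space M \<Longrightarrow> S t \<noteq> {}" and cl: "\<And>t. t \<in> space M \<Longrightarrow> closed (S t)"
    and g [measurable]: "g \<in> borel_measurable M"
  shows "(\<lambda>t. infdist (g t) (S t)) \<in> borel_measurable M"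
proof (rule Castaing_representation_exists[OF S ne cl])
  fix f :: "nat \<Rightarrow> 'a \<Rightarrow> 'b"
  assume f [measurable]: "\<And>i. f i \<in> borel_measurable M"
    and fS: "\<And>i t. t \<in> space M \<Longrightarrow> f i t \<in> S t"
    and dense: "\<And>t U. t \<in> space M \<Longrightarrow> open U \<Longrightarrow> S t \<inter> U \<noteq> {} \<Longrightarrow> \<exists>i. f i t \<in> U"
  show ?thesis
  proof (rule borel_measurableI_less)
    fix r
    have "infdist (g t) (S t) < r \<longleftrightarrow> (\<exists>i. dist (g t) (f i t) < r)" if t: "t \<in> space M" for t
    proof
      assume "infdist (g t) (S t) < r"
      then have "S t \<inter> ball (g t) r \<noteq> {}" using infdist_less_iff[OF ne[OF t]] by auto
      then show "\<exists>i. dist (g t) (f i t) < r" using dense[OF t open_ball] by auto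
    qed (use infdist_less_iff[OF ne[OF t]] fS[OF t] in blast)
    then have "{t \<in> space M. infdist (g t) (S t) < r} = {t \<in> space M. \<exists>i. dist (g t) (f i t) < r}"
      by auto
    also have "\<dots> \<in> sets M" by measurable
    finally show "{t \<in> space M. infdist (g t) (S t) < r} \<in> sets M" .
  qed
qed auto

section \<open>Functions in \<open>L\<^sup>p\<close>\<close>

lemma enn2real_ge_1: "1 \<le> p \<Longrightarrow> p \<noteq> \<infinity> \<Longrightarrow> 1 \<le> enn2real p"
  using enn2real_mono[of 1 p] by (simp add: less_top[symmetric])

text \<open>Trades the essential supremum for an explicit almost everywhere bound, the form in which
  sums and multiples are estimated.\<close>

lemma Lp_fun_infinity_iff:
  "f \<in> Lp_fun \<infinity> M \<longleftrightarrow> f \<in> borel_measurable M \<and> (\<exists>K. AE t in M. norm (f t) \<le> K)"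
proof (intro iffI conjI; (elim conjE)?)
  assume f: "f \<in> Lp_fun \<infinity> M"
  then have fin: "esssup M (\<lambda>t. ennreal (norm (f t))) < top" by (simp add: Lp_fun_def)
  have "AE t in M. norm (f t) \<le> enn2real (esssup M (\<lambda>t. ennreal (norm (f t))))"
    using esssup_AE[of "\<lambda>t. ennreal (norm (f t))" M]
    by eventually_elim (use fin enn2real_mono in fastforce)
  then show "\<exists>K. AE t in M. norm (f t) \<le> K" ..
next
  assume [measurable]: "f \<in> borel_measurable M" and "\<exists>K. AE t in M. norm (f t) \<le> K"
  then obtain K where "AE t in M. norm (f t) \<le> K" by blast
  then have "esssup M (\<lambda>t. ennreal (norm (f t))) \<le> ennreal K"
    by (intro esssup_I) (auto intro: ennreal_leI)
  also have "\<dots> < top" by simp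
  finally show "f \<in> Lp_fun \<infinity> M" by (simp add: Lp_fun_def)
qed (simp add: Lp_fun_def)

lemma Lp_fun_scale:
  assumes f: "f \<in> Lp_fun p M"
  shows "(\<lambda>t. c *\<^sub>R f t) \<in> Lp_fun p M"
proof (cases "p = \<infinity>")
  case True
  obtain K where "AE t in M. norm (f t) \<le> K" using f True Lp_fun_infinity_iff by blast
  then have "AE t in M. norm (c *\<^sub>R f t) \<le> \<bar>c\<bar> * K"
    by eventually_elim (auto intro: mult_left_mono)
  then show ?thesis using f unfolding True Lp_fun_infinity_iff by auto
next
  case False
  then show ?thesis using f by (auto simp: Lp_fun_def powr_mult)
qed

lemma Lp_fun_add:
  assumes f: "f \<in> Lp_fun p M" and g: "g \<in> Lp_fun p M"
  shows "(\<lambda>t. f t + g t) \<in> Lp_fun p M"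
proof (cases "p = \<infinity>")
  case True
  obtain K L where "AE t in M. norm (f t) \<le> K" "AE t in M. norm (g t) \<le> L"
    using f g True Lp_fun_infinity_iff by metis
  then have "AE t in M. norm (f t + g t) \<le> K + L"
    by eventually_elim (auto intro: norm_triangle_mono)
  then show ?thesis using f g unfolding True Lp_fun_infinity_iff by auto
next
  case False
  define P where "P = enn2real p"
  have P: "0 \<le> P" by (simp add: P_def)
  have [measurable]: "f \<in> borel_measurable M" "g \<in> borel_measurable M"
    and int: "integrable M (\<lambda>t. norm (f t) powr P)" "integrable M (\<lambda>t. norm (g t) powr P)"
    using f g False by (auto simp: Lp_fun_def P_def)
  \<comment> \<open>A sum of two norms is at most twice the larger one; this yields an integrable
    majorant for every exponent \<open>P\<close> \<ge> 0.\<close>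
  have bound: "norm (f t + g t) powr P \<le> 2 powr P * (norm (f t) powr P + norm (g t) powr P)" for t
  proof -
    have "norm (f t + g t) powr P \<le> (2 * max (norm (f t)) (norm (g t))) powr P"
      using norm_triangle_ineq[of "f t" "g t"] by (intro powr_mono2 P) auto
    also have "\<dots> = 2 powr P * max (norm (f t)) (norm (g t)) powr P" by (simp add: powr_mult)
    also have "\<dots> \<le> 2 powr P * (norm (f t) powr P + norm (g t) powr P)"
      by (intro mult_left_mono) (auto simp: max_def)
    finally show ?thesis .
  qed
  have "integrable M (\<lambda>t. norm (f t + g t) powr P)"
  proof (rule Bochner_Integration.integrable_bound)
    show "integrable M (\<lambda>t. 2 powr P * (norm (f t) powr P + norm (g t) powr P))"
      using int by (intro integrable_mult_right Bochner_Integration.integrable_add)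
    show "AE t in M. norm (norm (f t + g t) powr P) \<le> norm (2 powr P * (norm (f t) powr P + norm (g t) powr P))"
    proof (rule AE_I2)
      fix t
      show "norm (norm (f t + g t) powr P) \<le> norm (2 powr P * (norm (f t) powr P + norm (g t) powr P))"
        using bound[of t] by (simp del: norm_mult)
    qed
  qed simp
  then show ?thesis using False by (simp add: Lp_fun_def P_def)
qed

text \<open>Taking a root moves \<open>m\<close> towards 1 without passing it. This bound and the
  companion lower bound remove the exponent from powers of a measure.\<close>

lemma powr_inverse_le_max:
  fixes m P :: real
  assumes "0 \<le> m" "1 \<le> P"
  shows "m powr (1 / P) \<le> max 1 m"
proof (cases "m \<le> 1")
  case True
  then show ?thesis using assms powr_le_one_le[of m] powr_mono2[of "1/P" m 1] by simp
next
  case False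
  then have "m powr (1 / P) \<le> m powr 1" using assms by (intro powr_mono) auto
  then show ?thesis using False by simp
qed

lemma powr_inverse_ge_min:
  fixes m P :: real
  assumes "0 \<le> m" "1 \<le> P"
  shows "min 1 m \<le> m powr (1 / P)"
proof (cases "m \<le> 1")
  case True
  show ?thesis
  proof (cases "m = 0")
    case False
    then have "m powr 1 \<le> m powr (1 / P)" using assms True by (intro powr_mono') auto
    then show ?thesis using True assms by simp
  qed simp
next
  case False
  then have "1 \<le> m powr (1 / P)" using assms by (intro ge_one_powr_ge_zero) auto
  then show ?thesis by simp
qed

text \<open>The factors \<open>max 1 \<mu>(E)\<close> and \<open>min 1 \<mu>(E)\<close> make the next two bounds uniform in \<open>1 \<le> p \<le> \<infinity>\<close>.\<close>

lemma Lp_bounded_support: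
  assumes p: "1 \<le> p" and f [measurable]: "f \<in> borel_measurable M"
    and E [measurable]: "E \<in> sets M" and fin: "emeasure M E < \<infinity>" and k: "0 \<le> k"
    and bound: "AE t in M. norm (f t) \<le> k * indicator E t"
  shows "f \<in> Lp_fun p M" "Lp_seminorm p M f \<le> k * max 1 (measure M E)"
proof -
  have "f \<in> Lp_fun p M \<and> Lp_seminorm p M f \<le> k * max 1 (measure M E)"
  proof (cases "p = \<infinity>")
    case True
    have "AE t in M. norm (f t) \<le> k" using bound
      by eventually_elim (use k in \<open>auto simp: indicator_def of_bool_def split: if_splits\<close>)
    then have "esssup M (\<lambda>t. ennreal (norm (f t))) \<le> ennreal k" "f \<in> Lp_fun \<infinity> M"
      unfolding Lp_fun_infinity_iff by (auto intro!: esssup_I intro: ennreal_leI)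
    then have "Lp_seminorm \<infinity> M f \<le> k"
      unfolding Lp_seminorm_def by (simp add: enn2real_leI k)
    also have "k \<le> k * max 1 (measure M E)" using k mult_left_mono[of 1 "max 1 (measure M E)" k] by simp
    finally show ?thesis using \<open>f \<in> Lp_fun \<infinity> M\<close> True by simp
  next
    case False
    define P where "P = enn2real p"
    have P: "1 \<le> P" using enn2real_ge_1[OF p False] by (simp add: P_def)
    have le: "AE t in M. norm (f t) powr P \<le> k powr P * indicator E t"
      using bound by eventually_elim (use P in \<open>auto simp: indicator_def intro: powr_mono2\<close>)
    have intE: "integrable M (\<lambda>t. k powr P * indicator E t)"
      using fin by (intro integrable_mult_right integrable_real_indicator) auto
    have int: "integrable M (\<lambda>t. norm (f t) powr P)"
      by (rule Bochner_Integration.integrable_bound[OF intE]) (use le in auto)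
    have "(\<integral>t. norm (f t) powr P \<partial>M) \<le> (\<integral>t. k powr P * indicator E t \<partial>M)"
      by (rule integral_mono_AE[OF int intE le])
    also have "\<dots> = k powr P * measure M E" by simp
    finally have "(\<integral>t. norm (f t) powr P \<partial>M) powr (1 / P) \<le> (k powr P * measure M E) powr (1 / P)"
      using P by (intro powr_mono2) (auto intro: integral_nonneg_AE)
    also have "\<dots> = k * measure M E powr (1 / P)"
      using P k by (simp add: powr_mult powr_powr)
    also have "\<dots> \<le> k * max 1 (measure M E)"
      using k P by (intro mult_left_mono powr_inverse_le_max) auto
    finally show ?thesis using False int by (simp add: Lp_seminorm_def Lp_fun_def P_def)
  qed
  then show "f \<in> Lp_fun p M" "Lp_seminorm p M f \<le> k * max 1 (measure M E)" by auto
qed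

lemma Lp_seminorm_lower_bound:
  assumes p: "1 \<le> p" and f: "f \<in> Lp_fun p M"
    and E [measurable]: "E \<in> sets M" and fin: "emeasure M E < \<infinity>" and k: "0 \<le> k"
    and bound: "\<And>t. t \<in> E \<Longrightarrow> k \<le> norm (f t)"
  shows "k * min 1 (measure M E) \<le> Lp_seminorm p M f"
proof (cases "measure M E = 0")
  case True
  then show ?thesis by (simp add: Lp_seminorm_def)
next
  case pos: False
  have f' [measurable]: "f \<in> borel_measurable M" using f by (simp add: Lp_fun_def)
  show ?thesis
  proof (cases "p = \<infinity>")
    case True
    have fin: "esssup M (\<lambda>t. ennreal (norm (f t))) < top" using f True by (simp add: Lp_fun_def)
    \<comment> \<open>If \<open>k\<close> exceeded the essential supremum, almost every point would
      lie outside \<open>E\<close>, although \<open>E\<close> has positive measure.\<close>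
    have "\<not> (AE t in M. t \<notin> E)"
      using pos AE_iff_null_sets[OF E] by (auto simp: measure_def)
    moreover have "AE t in M. t \<notin> E" if "\<not> ennreal k \<le> esssup M (\<lambda>t. ennreal (norm (f t)))"
      using esssup_AE[of "\<lambda>t. ennreal (norm (f t))" M]
      by eventually_elim (use that bound in \<open>auto dest: ennreal_leI intro: order_trans\<close>)
    ultimately have "ennreal k \<le> esssup M (\<lambda>t. ennreal (norm (f t)))" by blast
    then have "k \<le> Lp_seminorm p M f"
      using True fin k enn2real_mono[of "ennreal k" "esssup M (\<lambda>t. ennreal (norm (f t)))"] by (simp add: Lp_seminorm_def)
    moreover have "k * min 1 (measure M E) \<le> k * 1" by (intro mult_left_mono k) auto
    ultimately show ?thesis by simp
  next
    case False
    define P where "P = enn2real p"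
    have P: "1 \<le> P" using enn2real_ge_1[OF p False] by (simp add: P_def)
    have int: "integrable M (\<lambda>t. norm (f t) powr P)" using f False by (simp add: Lp_fun_def P_def)
    have "k * min 1 (measure M E) \<le> k * measure M E powr (1 / P)"
      using k P by (intro mult_left_mono powr_inverse_ge_min) auto
    also have "\<dots> = (k powr P * measure M E) powr (1 / P)"
      using P k by (simp add: powr_mult powr_powr)
    also have "k powr P * measure M E = (\<integral>t. k powr P * indicator E t \<partial>M)" by simp
    also have "\<dots> powr (1 / P) \<le> (\<integral>t. norm (f t) powr P \<partial>M) powr (1 / P)"
    proof (intro powr_mono2 integral_mono)
      show "integrable M (\<lambda>t. k powr P * indicator E t)"
        using fin by (intro integrable_mult_right integrable_real_indicator) auto
    qed (use P k int bound in \<open>auto simp: indicator_def intro: powr_mono2\<close>)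
    finally show ?thesis using False by (simp add: Lp_seminorm_def P_def)
  qed
qed

section \<open>Selections and their tangents in terms of representatives\<close>

lemma Sel_iff:
  assumes a: "a \<in> Lp_fun p M" and b: "b \<in> Lp_fun r M"
  shows "(Lp_class p M a, Lp_class r M b) \<in> Sel p r M S \<longleftrightarrow> (AE t in M. (a t, b t) \<in> S t)"
proof
  assume "(Lp_class p M a, Lp_class r M b) \<in> Sel p r M S"
  then obtain a' b' where eq: "Lp_class p M a = Lp_class p M a'" "Lp_class r M b = Lp_class r M b'"
    and ab: "a' \<in> Lp_fun p M" "b' \<in> Lp_fun r M" and S: "AE t in M. (a' t, b' t) \<in> S t"
    unfolding Sel_def by blast
  \<comment> \<open>Equal classes have representatives that agree almost everywhere, so the choice
    of representative affects only a null set.\<close>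
  have "a' \<in> Lp_class p M a" "b' \<in> Lp_class r M b" using Lp_class_self ab eq by auto
  then have "AE t in M. a t = a' t" "AE t in M. b t = b' t"
    using Lp_class_eq[OF a] Lp_class_eq[OF b] by auto
  with S show "AE t in M. (a t, b t) \<in> S t" by eventually_elim simp
qed (use a b in \<open>auto simp: Sel_def\<close>)

text \<open>Unfolds tangency between equivalence classes into almost everywhere statements about
  functions, so that the main argument can work pointwise.\<close>

lemma clarke_cone_SelD:
  assumes x: "x \<in> Lp_fun p M" and y: "y \<in> Lp_fun r M"
    and u: "u \<in> Lp_fun p M" and v: "v \<in> Lp_fun r M"
    and tangent: "(Lp_class p M u, Lp_class r M v) \<in>
      clarke_cone (sum_space (Lp_space p M) (Lp_space r M)) (Sel p r M S) (Lp_class p M x, Lp_class r M y)"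
    and \<epsilon>: "0 < \<epsilon>"
  obtains \<delta> \<tau> where "0 < \<delta>" "0 < \<tau>"
    "\<And>a b \<eta>. a \<in> Lp_fun p M \<Longrightarrow> b \<in> Lp_fun r M \<Longrightarrow> Lp_seminorm p M a + Lp_seminorm r M b \<le> 1 \<Longrightarrow>
      AE t in M. (x t + \<delta> *\<^sub>R a t, y t + \<delta> *\<^sub>R b t) \<in> S t \<Longrightarrow> 0 \<le> \<eta> \<Longrightarrow> \<eta> \<le> \<tau> \<Longrightarrow>
      \<exists>a'\<in>Lp_fun p M. \<exists>b'\<in>Lp_fun r M. Lp_seminorm p M a' + Lp_seminorm r M b' \<le> 1 \<and>
        (AE t in M. (x t + \<delta> *\<^sub>R a t + \<eta> *\<^sub>R (u t + \<epsilon> *\<^sub>R a' t),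
                     y t + \<delta> *\<^sub>R b t + \<eta> *\<^sub>R (v t + \<epsilon> *\<^sub>R b' t)) \<in> S t)"
proof -
  let ?L = "sum_space (Lp_space p M) (Lp_space r M)"
  have points_L: "points ?L = points (Lp_space p M) \<times> points (Lp_space r M)"
    and add_L: "add ?L w w' = (add (Lp_space p M) (fst w) (fst w'), add (Lp_space r M) (snd w) (snd w'))"
    and scale_L: "scale ?L c w = (scale (Lp_space p M) c (fst w), scale (Lp_space r M) c (snd w))"
    and nrm_L: "nrm ?L w = nrm (Lp_space p M) (fst w) + nrm (Lp_space r M) (snd w)" for w w' c
    by (simp_all add: sum_space_def)
  have shift: "add ?L (Lp_class p M f, Lp_class r M g) (scale ?L c (Lp_class p M a, Lp_class r M b))
      = (Lp_class p M (\<lambda>t. f t + c *\<^sub>R a t), Lp_class r M (\<lambda>t. g t + c *\<^sub>R b t))"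
    if "f \<in> Lp_fun p M" "g \<in> Lp_fun r M" "a \<in> Lp_fun p M" "b \<in> Lp_fun r M" for f g a b c
    using that by (simp add: add_L scale_L scale_Lp_class add_Lp_class Lp_fun_scale)
  obtain \<delta> \<tau> where \<delta>: "\<delta> > 0" and \<tau>: "\<tau> > 0" and
    step: "\<forall>w \<in> Sel p r M S \<inter> (\<lambda>b. add ?L (Lp_class p M x, Lp_class r M y) (scale ?L \<delta> b)) ` closed_unit_ball ?L.
       \<forall>\<eta> \<in> {0..\<tau>}. Sel p r M S \<inter>
         (\<lambda>b. add ?L w (scale ?L \<eta> (add ?L (Lp_class p M u, Lp_class r M v) (scale ?L \<epsilon> b)))) ` closed_unit_ball ?L \<noteq> {}"
    using tangent \<epsilon> unfolding clarke_cone_def by blast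
  show thesis
  proof (rule that[OF \<delta> \<tau>])
    fix a b \<eta>
    assume a: "a \<in> Lp_fun p M" and b: "b \<in> Lp_fun r M"
      and ab: "Lp_seminorm p M a + Lp_seminorm r M b \<le> 1"
      and S: "AE t in M. (x t + \<delta> *\<^sub>R a t, y t + \<delta> *\<^sub>R b t) \<in> S t"
      and \<eta>: "0 \<le> \<eta>" "\<eta> \<le> \<tau>"
    let ?x = "\<lambda>t. x t + \<delta> *\<^sub>R a t" and ?y = "\<lambda>t. y t + \<delta> *\<^sub>R b t"
    have xy: "?x \<in> Lp_fun p M" "?y \<in> Lp_fun r M" by (intro Lp_fun_add Lp_fun_scale x y a b)+
    have "(Lp_class p M a, Lp_class r M b) \<in> closed_unit_ball ?L"
      using a b ab by (auto simp: closed_unit_ball_def points_L nrm_L nrm_Lp_class points_Lp_space)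
    then have "(Lp_class p M ?x, Lp_class r M ?y) \<in> Sel p r M S \<inter>
        (\<lambda>b. add ?L (Lp_class p M x, Lp_class r M y) (scale ?L \<delta> b)) ` closed_unit_ball ?L"
      using S Sel_iff[OF xy, of S] shift[OF x y a b, of \<delta>] by (metis (no_types, lifting) IntI image_eqI)
    moreover have "\<eta> \<in> {0..\<tau>}" using \<eta> by simp
    ultimately have "Sel p r M S \<inter> (\<lambda>b. add ?L (Lp_class p M ?x, Lp_class r M ?y)
        (scale ?L \<eta> (add ?L (Lp_class p M u, Lp_class r M v) (scale ?L \<epsilon> b)))) ` closed_unit_ball ?L \<noteq> {}"
      using step by blast
    then obtain w where w: "w \<in> closed_unit_ball ?L" "add ?L (Lp_class p M ?x, Lp_class r M ?y)
        (scale ?L \<eta> (add ?L (Lp_class p M u, Lp_class r M v) (scale ?L \<epsilon> w))) \<in> Sel p r M S"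
      by blast
    then obtain a' b' where ab': "a' \<in> Lp_fun p M" "b' \<in> Lp_fun r M" "w = (Lp_class p M a', Lp_class r M b')"
      by (cases w) (auto simp: closed_unit_ball_def points_L points_Lp_space)
    have ue: "(\<lambda>t. u t + \<epsilon> *\<^sub>R a' t) \<in> Lp_fun p M" "(\<lambda>t. v t + \<epsilon> *\<^sub>R b' t) \<in> Lp_fun r M"
      by (intro Lp_fun_add Lp_fun_scale u v ab')+
    have "(Lp_class p M (\<lambda>t. ?x t + \<eta> *\<^sub>R (u t + \<epsilon> *\<^sub>R a' t)), Lp_class r M (\<lambda>t. ?y t + \<eta> *\<^sub>R (v t + \<epsilon> *\<^sub>R b' t)))
        \<in> Sel p r M S"
      using w(2) unfolding ab'(3) shift[OF u v ab'(1,2)] shift[OF xy ue] .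
    then have "AE t in M. (?x t + \<eta> *\<^sub>R (u t + \<epsilon> *\<^sub>R a' t), ?y t + \<eta> *\<^sub>R (v t + \<epsilon> *\<^sub>R b' t)) \<in> S t"
      using Sel_iff[OF Lp_fun_add[OF xy(1) Lp_fun_scale[OF ue(1)]] Lp_fun_add[OF xy(2) Lp_fun_scale[OF ue(2)]]]
      by blast
    moreover have "Lp_seminorm p M a' + Lp_seminorm r M b' \<le> 1"
      using w(1) ab' by (simp add: closed_unit_ball_def nrm_L nrm_Lp_class)
    ultimately show "\<exists>a'\<in>Lp_fun p M. \<exists>b'\<in>Lp_fun r M. Lp_seminorm p M a' + Lp_seminorm r M b' \<le> 1 \<and>
        (AE t in M. (?x t + \<eta> *\<^sub>R (u t + \<epsilon> *\<^sub>R a' t), ?y t + \<eta> *\<^sub>R (v t + \<epsilon> *\<^sub>R b' t)) \<in> S t)"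
      using ab' by blast
  qed
qed

section \<open>Failure of tangency\<close>

text \<open>The miss \<open>c * h\<close> is proportional to the step length, which makes
  \<open>c\<close> a rate. Both inequalities are strict, so the admissible \<open>z\<close> form a
  relatively open subset of \<open>C\<close> and can be found along a dense sequence.\<close>

definition escapes :: "'b::real_normed_vector set \<Rightarrow> 'b \<Rightarrow> 'b \<Rightarrow> real \<Rightarrow> real \<Rightarrow> real \<Rightarrow> bool" where
  "escapes C a v c \<rho> h \<longleftrightarrow> (\<exists>z\<in>C. dist z a < \<rho> \<and> c * h < infdist (z + h *\<^sub>R v) C)"

text \<open>If steps of length \<open>h\<close> from all points of \<open>C\<close> near \<open>a\<close> ended close to \<open>C\<close>, then many of them could
  be concatenated to a step of length \<open>\<eta>\<close>. So failure of tangency at a single \<open>\<eta>\<close> is inherited by all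
  sufficiently small step lengths \<open>h\<close>; this is what permits a step length independent of \<open>t\<close> below.\<close>

lemma escapes_of_large_step:
  fixes C :: "'b::real_normed_vector set"
  assumes z: "z \<in> C" and za: "dist z a \<le> \<rho> / 2"
    and \<eta>: "0 < \<eta>" "\<eta> * (norm v + \<epsilon>) < \<rho> / 2" and \<epsilon>: "0 < \<epsilon>"
    and disj: "C \<inter> cball (z + \<eta> *\<^sub>R v) (\<eta> * \<epsilon>) = {}"
    and h: "0 < h" "h * norm v \<le> \<eta> * \<epsilon> / 4"
  shows "escapes C a v (\<epsilon> / 2) \<rho> h"
proof (rule ccontr)
  assume no: "\<not> escapes C a v (\<epsilon> / 2) \<rho> h"
  \<comment> \<open>Each step costs at most \<open>\<epsilon> / 2 * h\<close> in distance to
    \<open>C\<close>. Enlarging this to \<open>3 * \<epsilon> / 4 * h\<close> gives an actual point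
    of \<open>C\<close>, and the remaining quarter of \<open>\<eta> * \<epsilon>\<close> is kept for
    the incomplete last step.\<close>
  have chain: "\<exists>w\<in>C. dist w (z + (real k * h) *\<^sub>R v) \<le> real k * h * (3 * \<epsilon> / 4)" if "real k * h \<le> \<eta>" for k
    using that
  proof (induction k)
    case 0
    then show ?case using z by force
  next
    case (Suc k)
    have kh: "real k * h \<le> \<eta>" using Suc.prems h by (simp add: algebra_simps)
    then obtain w where w: "w \<in> C" "dist w (z + (real k * h) *\<^sub>R v) \<le> real k * h * (3 * \<epsilon> / 4)"
      using Suc.IH by blast
    \<comment> \<open>The chain has to stay within \<rho> of \<open>a\<close>, where the absence of
      escapes can be used: half of \<rho> is spent by \<open>z\<close>, the other half bounds the
      drift from \<open>z\<close>.\<close>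
    have "dist w z \<le> real k * h * (3 * \<epsilon> / 4) + norm ((real k * h) *\<^sub>R v)"
      using dist_triangle[of w z "z + (real k * h) *\<^sub>R v"] w(2) by (simp add: dist_norm)
    also have "norm ((real k * h) *\<^sub>R v) = real k * h * norm v" using h by simp
    also have "real k * h * (3 * \<epsilon> / 4) + real k * h * norm v \<le> \<eta> * \<epsilon> + \<eta> * norm v"
      using kh h \<epsilon> \<eta>(1) by (intro add_mono mult_mono) auto
    also have "\<dots> < \<rho> / 2" using \<eta>(2) by (simp add: algebra_simps)
    finally have "dist w a < \<rho>" using za dist_triangle[of w a z] by linarith
    then have "infdist (w + h *\<^sub>R v) C \<le> \<epsilon> / 2 * h" using no w(1) by (auto simp: escapes_def not_less)
    also have "\<dots> < h * (3 * \<epsilon> / 4)" using h \<epsilon> by simp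
    finally obtain w' where w': "w' \<in> C" "dist (w + h *\<^sub>R v) w' < h * (3 * \<epsilon> / 4)"
      using infdist_less_iff z by blast
    have "dist w' (z + (real (Suc k) * h) *\<^sub>R v)
        \<le> dist w' (w + h *\<^sub>R v) + dist (w + h *\<^sub>R v) (z + (real (Suc k) * h) *\<^sub>R v)"
      by (rule dist_triangle)
    also have "dist (w + h *\<^sub>R v) (z + (real (Suc k) * h) *\<^sub>R v) = dist w (z + (real k * h) *\<^sub>R v)"
      by (simp add: dist_norm algebra_simps)
    finally have "dist w' (z + (real (Suc k) * h) *\<^sub>R v) \<le> h * (3 * \<epsilon> / 4) + real k * h * (3 * \<epsilon> / 4)"
      using w(2) w'(2) by (simp add: dist_commute)
    also have "\<dots> = real (Suc k) * h * (3 * \<epsilon> / 4)" by (simp add: algebra_simps)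
    finally show ?case using w'(1) by blast
  qed
  \<comment> \<open>The largest number of full steps fitting into \<eta>; the remainder is shorter
    than \<open>h\<close> and so displaces by at most \<open>h * norm v\<close>.\<close>
  define N where "N = nat \<lfloor>\<eta> / h\<rfloor>"
  have "0 \<le> \<eta> / h" using \<eta>(1) h(1) by simp
  then have "real N \<le> \<eta> / h" "\<eta> / h < real N + 1" unfolding N_def by linarith+
  then have N: "real N * h \<le> \<eta>" "\<eta> < real N * h + h" using h(1) by (auto simp: field_simps)
  obtain w where w: "w \<in> C" "dist w (z + (real N * h) *\<^sub>R v) \<le> real N * h * (3 * \<epsilon> / 4)"
    using chain[OF N(1)] by blast
  have "dist (z + (real N * h) *\<^sub>R v) (z + \<eta> *\<^sub>R v) = (\<eta> - real N * h) * norm v"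
    using N(1) by (simp add: dist_norm flip: scaleR_left_diff_distrib)
  also have "\<dots> \<le> h * norm v" using N(2) by (intro mult_right_mono) auto
  also have "\<dots> \<le> \<eta> * \<epsilon> / 4" by (rule h)
  finally have 1: "dist (z + (real N * h) *\<^sub>R v) (z + \<eta> *\<^sub>R v) \<le> \<eta> * \<epsilon> / 4" .
  have "real N * h * (3 * \<epsilon> / 4) \<le> \<eta> * (3 * \<epsilon> / 4)" using N(1) \<epsilon> by (intro mult_right_mono) auto
  then have "dist w (z + \<eta> *\<^sub>R v) \<le> \<eta> * \<epsilon>"
    using w(2) 1 dist_triangle[of w "z + \<eta> *\<^sub>R v" "z + (real N * h) *\<^sub>R v"] by linarith
  then show False using disj w(1) by (auto simp: dist_commute)
qed

lemma escapes_mono: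
  "escapes C a v c \<rho> h \<Longrightarrow> c' \<le> c \<Longrightarrow> \<rho> \<le> \<rho>' \<Longrightarrow> 0 \<le> h \<Longrightarrow> escapes C a v c' \<rho>' h"
  unfolding escapes_def by (meson le_less_trans less_le_trans mult_right_mono)

lemma eventually_inverse_Suc_less: "0 < e \<Longrightarrow> \<forall>\<^sub>F m in sequentially. 1 / real (Suc m) < e"
  using order_tendstoD(2)[OF LIMSEQ_inverse_real_of_nat] by (simp add: inverse_eq_divide)

text \<open>The \<epsilon> violating the cone condition gives, for every \<rho>, a bad step of some
  length, which concatenation passes on to all small lengths. The rate is independent of \<rho> and
  taken from a countable set, so that the exceptional points can later be split into countably many
  sets.\<close>

lemma not_clarke_cone_escapes:
  fixes C :: "('y::real_normed_vector \<times> 'z::real_normed_vector) set"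
  assumes "v \<notin> clarke_cone (sum_space type_space type_space) C a"
  obtains k where
    "\<And>\<rho>. 0 < \<rho> \<Longrightarrow> \<forall>\<^sub>F m in sequentially. escapes C a v (1 / real (Suc k)) \<rho> (1 / real (Suc m))"
proof -
  let ?E = "sum_space type_space type_space :: ('y \<times> 'z) normed_structure"
  have E: "points ?E = UNIV" "add ?E = (+)" "scale ?E = (*\<^sub>R)" "nrm ?E w = norm (fst w) + norm (snd w)" for w
    by (auto simp: sum_space_def type_space_def fun_eq_iff prod_eq_iff)
  obtain \<epsilon> where \<epsilon>: "\<epsilon> > 0" and bad: "\<And>\<delta> \<tau>. \<delta> > 0 \<Longrightarrow> \<tau> > 0 \<Longrightarrow>
      \<exists>z \<in> C \<inter> (\<lambda>b. a + \<delta> *\<^sub>R b) ` closed_unit_ball ?E. \<exists>\<eta> \<in> {0..\<tau>}.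
        C \<inter> (\<lambda>b. z + \<eta> *\<^sub>R (v + \<epsilon> *\<^sub>R b)) ` closed_unit_ball ?E = {}"
    using assms unfolding clarke_cone_def E by auto
  \<comment> \<open>One factor 1/2 is lost in passing from the sum norm to the product norm, another
    in concatenating steps.\<close>
  obtain k where k: "1 / real (Suc k) < \<epsilon> / 4"
    using eventually_inverse_Suc_less[of "\<epsilon> / 4"] \<epsilon> by (auto simp: eventually_sequentially)
  show thesis
  proof (rule that[of k])
    fix \<rho> :: real assume \<rho>: "0 < \<rho>"
    \<comment> \<open>Chosen so that steps of length at most \<tau> drift by no more than \<rho>/4,
      within the allowance of \<open>escapes_of_large_step\<close>.\<close>
    define \<tau> where "\<tau> = \<rho> / (4 * (norm v + \<epsilon>))"
    have \<tau>: "\<tau> > 0" "\<tau> * (norm v + \<epsilon>) = \<rho> / 4"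
      using \<rho> \<epsilon> add_nonneg_pos[OF norm_ge_zero[of v] \<epsilon>] by (auto simp: \<tau>_def field_simps)
    obtain b \<eta> where b: "b \<in> closed_unit_ball ?E" and z: "a + (\<rho> / 2) *\<^sub>R b \<in> C" and \<eta>: "0 \<le> \<eta>" "\<eta> \<le> \<tau>"
      and disj: "C \<inter> (\<lambda>b'. a + (\<rho> / 2) *\<^sub>R b + \<eta> *\<^sub>R (v + \<epsilon> *\<^sub>R b')) ` closed_unit_ball ?E = {}"
      using bad[of "\<rho> / 2" \<tau>] \<rho> \<tau>(1) by auto
    define z where "z = a + (\<rho> / 2) *\<^sub>R b"
    have zero: "0 \<in> closed_unit_ball ?E" by (simp add: closed_unit_ball_def E)
    \<comment> \<open>A step of length zero ends at the point itself, which lies in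
      \<open>C\<close>.\<close>
    have "\<eta> \<noteq> 0"
      using disj z zero by force
    then have \<eta>0: "\<eta> > 0" using \<eta> by simp
    have "norm b \<le> 1"
      using b norm_Pair_le[of "fst b" "snd b"] by (simp add: closed_unit_ball_def E)
    then have za: "dist z a \<le> \<rho> / 2" using \<rho> by (simp add: z_def dist_norm)
    \<comment> \<open>Each coordinate is bounded by the product norm, so the sum norm is at most
      twice that norm; halving \<epsilon> puts the product-norm ball inside the sum-norm
      ball.\<close>
    have "C \<inter> cball (z + \<eta> *\<^sub>R v) (\<eta> * (\<epsilon> / 2)) = {}"
    proof (rule ccontr)
      assume "C \<inter> cball (z + \<eta> *\<^sub>R v) (\<eta> * (\<epsilon> / 2)) \<noteq> {}"
      then obtain w where w: "w \<in> C" "norm (w - z - \<eta> *\<^sub>R v) \<le> \<eta> * (\<epsilon> / 2)"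
        by (auto simp: dist_norm norm_minus_commute algebra_simps)
      define b' where "b' = (1 / (\<eta> * \<epsilon>)) *\<^sub>R (w - z - \<eta> *\<^sub>R v)"
      have "norm b' = norm (w - z - \<eta> *\<^sub>R v) / (\<eta> * \<epsilon>)" using \<eta>0 \<epsilon> by (simp only: b'_def norm_scaleR) simp
      then have "norm b' \<le> 1 / 2" using w(2) \<eta>0 \<epsilon> by (simp add: pos_divide_le_eq)
      moreover have "norm (fst b') \<le> norm b'" "norm (snd b') \<le> norm b'"
        by (metis norm_fst_le norm_snd_le prod.collapse)+
      ultimately have "b' \<in> closed_unit_ball ?E" by (simp add: closed_unit_ball_def E)
      moreover have "w = z + \<eta> *\<^sub>R (v + \<epsilon> *\<^sub>R b')"
        using \<eta>0 \<epsilon> by (simp add: b'_def scaleR_add_right)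
      ultimately show False using disj w(1) unfolding z_def by blast
    qed
    moreover have "\<eta> * (norm v + \<epsilon> / 2) < \<rho> / 2"
    proof -
      have "\<eta> * (norm v + \<epsilon> / 2) \<le> \<tau> * (norm v + \<epsilon>)" using \<eta> \<epsilon> by (intro mult_mono) auto
      then show ?thesis using \<tau>(2) \<rho> by simp
    qed
    ultimately have step: "escapes C a v (\<epsilon> / 2 / 2) \<rho> h" if "0 < h" "h * norm v \<le> \<eta> * (\<epsilon> / 2) / 4" for h
      using z za \<eta>0 \<epsilon> that unfolding z_def by (intro escapes_of_large_step[of "a + (\<rho> / 2) *\<^sub>R b"]) auto
    \<comment> \<open>The threshold comes from
      \<open>h * norm v \<le> \<eta> * (\<epsilon> / 2) / 4\<close>; the added 1 covers
      \<open>v = 0\<close>.\<close>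
    have "0 < \<eta> * \<epsilon> / 8 / (norm v + 1)" using \<eta>0 \<epsilon> norm_ge_zero[of v] by (auto intro!: divide_pos_pos add_nonneg_pos)
    from eventually_inverse_Suc_less[OF this]
    show "\<forall>\<^sub>F m in sequentially. escapes C a v (1 / real (Suc k)) \<rho> (1 / real (Suc m))"
    proof eventually_elim
      case (elim m)
      have "1 / real (Suc m) * norm v \<le> 1 / real (Suc m) * (norm v + 1)" by (intro mult_left_mono) auto
      also have "\<dots> \<le> \<eta> * \<epsilon> / 8"
        using elim norm_ge_zero[of v] by (simp add: pos_less_divide_eq add_nonneg_pos add.commute mult.commute)
      finally have "escapes C a v (\<epsilon> / 2 / 2) \<rho> (1 / real (Suc m))" by (intro step) auto
      then show ?case by (rule escapes_mono) (use k in auto)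
    qed
  qed
qed

text \<open>Along a Castaing sequence, escaping becomes a countable disjunction of measurable
  conditions, and the first index that succeeds gives a measurable point of escape.\<close>

lemma escapes_measurable_selection:
  fixes S :: "'a \<Rightarrow> 'b::{banach, second_countable_topology} set"
  assumes S: "measurable_multifunction M S"
    and ne: "\<And>t. t \<in> space M \<Longrightarrow> S t \<noteq> {}" and cl: "\<And>t. t \<in> space M \<Longrightarrow> closed (S t)"
    and a [measurable]: "a \<in> borel_measurable M" and v [measurable]: "v \<in> borel_measurable M"
  shows "Measurable.pred M (\<lambda>t. escapes (S t) (a t) (v t) c \<rho> h)"
    and "\<exists>\<xi>\<in>borel_measurable M. \<forall>t\<in>space M. escapes (S t) (a t) (v t) c \<rho> h \<longrightarrow>
           \<xi> t \<in> S t \<and> dist (\<xi> t) (a t) < \<rho> \<and> c * h < infdist (\<xi> t + h *\<^sub>R v t) (S t)"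
proof -
  obtain f where f [measurable]: "\<And>i. f i \<in> borel_measurable M"
    and fS: "\<And>i t. t \<in> space M \<Longrightarrow> f i t \<in> S t"
    and dense: "\<And>t U. t \<in> space M \<Longrightarrow> open U \<Longrightarrow> S t \<inter> U \<noteq> {} \<Longrightarrow> \<exists>i::nat. f i t \<in> U"
    using Castaing_representation_exists[OF S ne cl] by metis
  define Q where "Q i t \<longleftrightarrow> dist (f i t) (a t) < \<rho> \<and> c * h < infdist (f i t + h *\<^sub>R v t) (S t)" for i t
  have [measurable]: "(\<lambda>t. infdist (f i t + h *\<^sub>R v t) (S t)) \<in> borel_measurable M" for i
    by (rule borel_measurable_infdist_multifunction[OF S ne cl]) auto
  have [measurable]: "Measurable.pred M (Q i)" for i
    unfolding Q_def by measurable
  have iff: "escapes (S t) (a t) (v t) c \<rho> h \<longleftrightarrow> (\<exists>i. Q i t)" if t: "t \<in> space M" for t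
  proof
    assume e: "escapes (S t) (a t) (v t) c \<rho> h"
    \<comment> \<open>Openness moves a witness in \<open>S t\<close> to a member of the dense
      sequence.\<close>
    have "open ({z. dist z (a t) < \<rho>} \<inter> {z. c * h < infdist (z + h *\<^sub>R v t) (S t)})"
      by (intro open_Int open_Collect_less continuous_intros)
    from dense[OF t this] e show "\<exists>i. Q i t" by (auto simp: escapes_def Q_def)
  qed (use fS[OF t] in \<open>auto simp: escapes_def Q_def\<close>)
  show "Measurable.pred M (\<lambda>t. escapes (S t) (a t) (v t) c \<rho> h)"
    by (subst measurable_cong[OF iff]) auto
  \<comment> \<open>Where no index qualifies, \<open>LEAST\<close> is one fixed unspecified number,
    so \<open>J\<close> is measurable there too.\<close>
  define J where "J t = (LEAST i. Q i t)" for t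
  have J [measurable]: "J \<in> measurable M (count_space UNIV)" unfolding J_def by measurable
  show "\<exists>\<xi>\<in>borel_measurable M. \<forall>t\<in>space M. escapes (S t) (a t) (v t) c \<rho> h \<longrightarrow>
      \<xi> t \<in> S t \<and> dist (\<xi> t) (a t) < \<rho> \<and> c * h < infdist (\<xi> t + h *\<^sub>R v t) (S t)"
  proof (intro bexI[where x="\<lambda>t. f (J t) t"] ballI impI)
    show "(\<lambda>t. f (J t) t) \<in> borel_measurable M"
      by (rule measurable_compose_countable[OF f J])
    fix t assume t: "t \<in> space M" and "escapes (S t) (a t) (v t) c \<rho> h"
    then have "\<exists>i. Q i t" using iff[OF t] by simp
    then have "Q (J t) t" unfolding J_def by (rule LeastI_ex)
    then show "f (J t) t \<in> S t \<and> dist (f (J t) t) (a t) < \<rho> \<and> c * h < infdist (f (J t) t + h *\<^sub>R v t) (S t)"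
      using fS[OF t] by (simp add: Q_def)
  qed
qed

section \<open>Tangents of the set of selections\<close>

text \<open>The constants are fixed in the order \<alpha>, \<beta>, \<epsilon>, then \<delta> and
  \<tau> from tangency, then \<rho>, and \<open>h\<close> last: the bounds that contradict each
  other do not depend on \<open>h\<close>, so it may be taken as small as required.\<close>

lemma null_of_eventually_escapes:
  fixes x u :: "'a \<Rightarrow> 'y::{banach, second_countable_topology}"
    and y v :: "'a \<Rightarrow> 'z::{banach, second_countable_topology}"
  assumes p: "1 \<le> p" and r: "1 \<le> r"
    and S: "measurable_multifunction M S"
    and ne: "\<And>t. t \<in> space M \<Longrightarrow> S t \<noteq> {}" and cl: "\<And>t. t \<in> space M \<Longrightarrow> closed (S t)"
    and x: "x \<in> Lp_fun p M" and y: "y \<in> Lp_fun r M"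
    and xyS: "AE t in M. (x t, y t) \<in> S t"
    and u: "u \<in> Lp_fun p M" and v: "v \<in> Lp_fun r M"
    and tangent: "(Lp_class p M u, Lp_class r M v) \<in>
      clarke_cone (sum_space (Lp_space p M) (Lp_space r M)) (Sel p r M S) (Lp_class p M x, Lp_class r M y)"
    and c: "0 < c" and D: "D \<in> sets M" and fin: "emeasure M D < \<infinity>"
    and esc: "\<And>t \<rho>. t \<in> D \<Longrightarrow> 0 < \<rho> \<Longrightarrow>
      \<forall>\<^sub>F m in sequentially. escapes (S t) (x t, y t) (u t, v t) c \<rho> (1 / real (Suc m))"
  shows "emeasure M D = 0"
proof (rule ccontr)
  assume nonnull: "emeasure M D \<noteq> 0"
  have [measurable]: "x \<in> borel_measurable M" "y \<in> borel_measurable M"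
      "u \<in> borel_measurable M" "v \<in> borel_measurable M" "D \<in> sets M"
    using x y u v D by (auto simp: Lp_fun_def)
  define \<alpha> where "\<alpha> = measure M D"
  have \<alpha>: "0 < \<alpha>" using nonnull fin by (simp add: \<alpha>_def measure_def enn2real_positive_iff zero_less_iff_neq_zero)
  \<comment> \<open>A lower bound for \<open>min 1 (measure M E1)\<close> or
    \<open>min 1 (measure M E2)\<close> below, one of these sets having measure at least
    \<alpha>/4.\<close>
  define \<beta> where "\<beta> = min 1 (\<alpha> / 4)"
  have \<beta>: "0 < \<beta>" using \<alpha> by (simp add: \<beta>_def)
  \<comment> \<open>Makes \<open>c / (2 * \<epsilon>) * \<beta>\<close> equal to 2, beyond the
    radius of the unit ball.\<close>
  define \<epsilon> where "\<epsilon> = c * \<beta> / 4"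
  have \<epsilon>: "0 < \<epsilon>" using c \<beta> by (simp add: \<epsilon>_def)
  obtain \<delta> \<tau> where \<delta>: "0 < \<delta>" and \<tau>: "0 < \<tau>"
    and step: "\<And>a b \<eta>. a \<in> Lp_fun p M \<Longrightarrow> b \<in> Lp_fun r M \<Longrightarrow> Lp_seminorm p M a + Lp_seminorm r M b \<le> 1 \<Longrightarrow>
      AE t in M. (x t + \<delta> *\<^sub>R a t, y t + \<delta> *\<^sub>R b t) \<in> S t \<Longrightarrow> 0 \<le> \<eta> \<Longrightarrow> \<eta> \<le> \<tau> \<Longrightarrow>
      \<exists>a'\<in>Lp_fun p M. \<exists>b'\<in>Lp_fun r M. Lp_seminorm p M a' + Lp_seminorm r M b' \<le> 1 \<and>
        (AE t in M. (x t + \<delta> *\<^sub>R a t + \<eta> *\<^sub>R (u t + \<epsilon> *\<^sub>R a' t),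
                     y t + \<delta> *\<^sub>R b t + \<eta> *\<^sub>R (v t + \<epsilon> *\<^sub>R b' t)) \<in> S t)"
    using clarke_cone_SelD[OF x y u v tangent \<epsilon>] by blast
  define K where "K = max 1 \<alpha>"
  have K: "1 \<le> K" by (simp add: K_def)
  \<comment> \<open>A displacement of size \<rho> on a subset of \<open>D\<close>, divided by
    \<delta>, then has norm at most 1/2 in each factor, hence at most 1 in the product.\<close>
  define \<rho> where "\<rho> = \<delta> / (2 * K)"
  have \<rho>: "0 < \<rho>" using \<delta> K by (simp add: \<rho>_def)
  let ?esc = "\<lambda>m t. escapes (S t) (x t, y t) (u t, v t) c \<rho> (1 / real (Suc m))"
  have [measurable]: "Measurable.pred M (?esc m)" for m
    by (rule escapes_measurable_selection(1)[OF S ne cl]) auto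
  define F where "F n = {t \<in> D. \<forall>m\<ge>n. ?esc m t}" for n
  have F [measurable]: "F n \<in> sets M" for n
  proof -
    have "F n = D \<inter> {t \<in> space M. \<forall>m\<ge>n. ?esc m t}"
      using sets.sets_into_space[OF D] by (auto simp: F_def)
    also have "\<dots> \<in> sets M" by measurable
    finally show ?thesis .
  qed
  have fin_sub: "emeasure M X < \<infinity>" if "X \<subseteq> D" for X
    using emeasure_mono[OF that D] fin by (rule le_less_trans)
  have FD: "F n \<subseteq> D" for n by (auto simp: F_def)
  \<comment> \<open>Continuity from below fixes \<open>n\<close> with more than half of the measure;
    afterwards any \<open>m\<close> \<ge> \<open>n\<close> serves as the common step.\<close>
  have "(\<lambda>n. measure M (F n)) \<longlonglongrightarrow> measure M (\<Union>n. F n)"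
  proof (rule Lim_measure_incseq)
    show "emeasure M (\<Union>n. F n) \<noteq> \<infinity>"
      using FD by (intro less_imp_neq fin_sub UN_least)
    show "incseq F" by (auto simp: F_def incseq_def)
  qed (use F in blast)
  also have "(\<Union>n. F n) = D"
    using esc[OF _ \<rho>] by (auto simp: F_def eventually_sequentially)
  finally have "\<forall>\<^sub>F n in sequentially. \<alpha> / 2 < measure M (F n)"
    using \<alpha> by (intro order_tendstoD(1)) (auto simp: \<alpha>_def)
  then obtain n where n: "\<alpha> / 2 < measure M (F n)" by (auto simp: eventually_sequentially)
  obtain m where m: "n \<le> m" "1 / real (Suc m) < \<tau>"
    using eventually_conj[OF eventually_ge_at_top[of n] eventually_inverse_Suc_less[OF \<tau>]]
    by (auto simp: eventually_sequentially simp del: of_nat_Suc)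
  define h where "h = 1 / real (Suc m)"
  have h: "0 < h" "h \<le> \<tau>" using m(2) by (auto simp: h_def)
  define E where "E = F n"
  have E [measurable]: "E \<in> sets M" and ED: "E \<subseteq> D" and \<alpha>E: "\<alpha> / 2 < measure M E"
    unfolding E_def using F FD n by blast+
  have Eesc: "escapes (S t) (x t, y t) (u t, v t) c \<rho> h" if "t \<in> E" for t
    using that m(1) unfolding E_def F_def h_def by blast
  have EK: "max 1 (measure M E) \<le> K"
    using measure_mono_fmeasurable[OF ED E] fin D by (auto simp: K_def \<alpha>_def fmeasurable_def)
  obtain \<xi> where \<xi>m [measurable]: "\<xi> \<in> borel_measurable M"
    and \<xi>: "\<And>t. t \<in> E \<Longrightarrow> \<xi> t \<in> S t \<and> dist (\<xi> t) (x t, y t) < \<rho> \<and> c * h < infdist (\<xi> t + h *\<^sub>R (u t, v t)) (S t)"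
  proof -
    have "\<exists>\<xi>\<in>borel_measurable M. \<forall>t\<in>space M. escapes (S t) (x t, y t) (u t, v t) c \<rho> h \<longrightarrow>
        \<xi> t \<in> S t \<and> dist (\<xi> t) (x t, y t) < \<rho> \<and> c * h < infdist (\<xi> t + h *\<^sub>R (u t, v t)) (S t)"
      by (rule escapes_measurable_selection(2)[OF S ne cl]) auto
    then show thesis using that Eesc sets.sets_into_space[OF E] by blast
  qed
  have [measurable]: "(\<lambda>t. fst (\<xi> t)) \<in> borel_measurable M" "(\<lambda>t. snd (\<xi> t)) \<in> borel_measurable M"
    by (rule borel_measurable_continuous_on[OF _ \<xi>m]; intro continuous_intros)+
  \<comment> \<open>The displacement from \<open>(x, y)\<close> to \<xi> on \<open>E\<close>, in
    units of \<delta>, and zero elsewhere, where \<open>(x, y)\<close> itself already selects from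
    \<open>S\<close>.\<close>
  define a where "a t = indicator E t *\<^sub>R (1 / \<delta>) *\<^sub>R (fst (\<xi> t) - x t)" for t
  define b where "b t = indicator E t *\<^sub>R (1 / \<delta>) *\<^sub>R (snd (\<xi> t) - y t)" for t
  have [measurable]: "a \<in> borel_measurable M" "b \<in> borel_measurable M"
    unfolding a_def b_def by measurable
  have perturbed: "(x t + \<delta> *\<^sub>R a t, y t + \<delta> *\<^sub>R b t) = (if t \<in> E then \<xi> t else (x t, y t))" for t
    using \<delta> by (simp add: a_def b_def)
  have le: "norm (a t) \<le> \<rho> / \<delta> * indicator E t" "norm (b t) \<le> \<rho> / \<delta> * indicator E t" for t
  proof -
    have "norm (fst (\<xi> t) - x t) \<le> \<rho>" "norm (snd (\<xi> t) - y t) \<le> \<rho>" if "t \<in> E"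
      using \<xi>[OF that] norm_fst_le[of "fst (\<xi> t) - x t" "snd (\<xi> t) - y t"]
        norm_snd_le[of "snd (\<xi> t) - y t" "fst (\<xi> t) - x t"]
      by (cases "\<xi> t"; simp add: dist_norm)+
    then show "norm (a t) \<le> \<rho> / \<delta> * indicator E t" "norm (b t) \<le> \<rho> / \<delta> * indicator E t"
      using \<delta> by (auto simp: a_def b_def indicator_def divide_right_mono)
  qed
  have k0: "0 \<le> \<rho> / \<delta>" using \<rho> \<delta> by simp
  have aL: "a \<in> Lp_fun p M" and "Lp_seminorm p M a \<le> \<rho> / \<delta> * max 1 (measure M E)"
    using Lp_bounded_support[OF p _ E fin_sub[OF ED] k0, of a] le(1) by auto
  moreover have bL: "b \<in> Lp_fun r M" and "Lp_seminorm r M b \<le> \<rho> / \<delta> * max 1 (measure M E)"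
    using Lp_bounded_support[OF r _ E fin_sub[OF ED] k0, of b] le(2) by auto
  moreover have "\<rho> / \<delta> * max 1 (measure M E) \<le> \<rho> / \<delta> * K" using EK k0 by (rule mult_left_mono)
  moreover have "\<rho> / \<delta> * K = 1 / 2" using \<delta> K by (simp add: \<rho>_def)
  ultimately have ab: "Lp_seminorm p M a + Lp_seminorm r M b \<le> 1" by linarith
  have "AE t in M. (x t + \<delta> *\<^sub>R a t, y t + \<delta> *\<^sub>R b t) \<in> S t"
    using xyS by eventually_elim (use \<xi> in \<open>simp add: perturbed\<close>)
  from step[OF aL bL ab this less_imp_le[OF h(1)] h(2)]
  obtain a' b' where a': "a' \<in> Lp_fun p M" and b': "b' \<in> Lp_fun r M"
    and ab': "Lp_seminorm p M a' + Lp_seminorm r M b' \<le> 1"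
    and S': "AE t in M. (x t + \<delta> *\<^sub>R a t + h *\<^sub>R (u t + \<epsilon> *\<^sub>R a' t), y t + \<delta> *\<^sub>R b t + h *\<^sub>R (v t + \<epsilon> *\<^sub>R b' t)) \<in> S t"
    by blast
  have [measurable]: "a' \<in> borel_measurable M" "b' \<in> borel_measurable M"
    using a' b' by (auto simp: Lp_fun_def)
  \<comment> \<open>Half of \<open>c / \<epsilon>\<close>: if the two norms sum to more than
    \<open>2 * k\<close>, one of them is at least \<open>k\<close>.\<close>
  define k where "k = c / (2 * \<epsilon>)"
  have k: "0 \<le> k" "k * \<beta> = 2" using c \<beta> by (auto simp: k_def \<epsilon>_def)
  define E1 where "E1 = {t \<in> E. k \<le> norm (a' t)}"
  define E2 where "E2 = {t \<in> E. k \<le> norm (b' t)}"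
  have E12 [measurable]: "E1 \<in> sets M" "E2 \<in> sets M"
  proof -
    have "E1 = E \<inter> {t \<in> space M. k \<le> norm (a' t)}" "E2 = E \<inter> {t \<in> space M. k \<le> norm (b' t)}"
      using sets.sets_into_space[OF E] by (auto simp: E1_def E2_def)
    then show "E1 \<in> sets M" "E2 \<in> sets M" by auto
  qed
  have E12_sub: "E1 \<subseteq> D" "E2 \<subseteq> D" using ED by (auto simp: E1_def E2_def)
  \<comment> \<open>On \<open>E\<close> the point provided by tangency differs from
    \<open>\<xi> t + h *\<^sub>R (u t, v t)\<close> by the correction
    \<open>(h * \<epsilon>) *\<^sub>R (a' t, b' t)\<close>, while \<xi> misses \<open>S t\<close> by
    more than \<open>c * h\<close>. Cancelling \<open>h\<close> forces a large correction.\<close>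
  have "AE t in M. t \<in> E \<longrightarrow> t \<in> E1 \<union> E2"
    using S'
  proof (eventually_elim, intro impI)
    fix t
    assume S't: "(x t + \<delta> *\<^sub>R a t + h *\<^sub>R (u t + \<epsilon> *\<^sub>R a' t), y t + \<delta> *\<^sub>R b t + h *\<^sub>R (v t + \<epsilon> *\<^sub>R b' t)) \<in> S t"
      and t: "t \<in> E"
    have "(x t + \<delta> *\<^sub>R a t + h *\<^sub>R (u t + \<epsilon> *\<^sub>R a' t), y t + \<delta> *\<^sub>R b t + h *\<^sub>R (v t + \<epsilon> *\<^sub>R b' t))
        = (x t + \<delta> *\<^sub>R a t, y t + \<delta> *\<^sub>R b t) + (h *\<^sub>R (u t, v t) + (h * \<epsilon>) *\<^sub>R (a' t, b' t))"
      by (simp add: scaleR_add_right)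
    also have "\<dots> = (\<xi> t + h *\<^sub>R (u t, v t)) + (h * \<epsilon>) *\<^sub>R (a' t, b' t)"
      unfolding perturbed using t by (simp only: if_True add.assoc)
    finally have "(\<xi> t + h *\<^sub>R (u t, v t)) + (h * \<epsilon>) *\<^sub>R (a' t, b' t) \<in> S t" using S't by simp
    then have "infdist (\<xi> t + h *\<^sub>R (u t, v t)) (S t) \<le> norm ((h * \<epsilon>) *\<^sub>R (a' t, b' t))"
      by (rule infdist_le2) (simp add: dist_norm del: scaleR_Pair norm_scaleR)
    also have "\<dots> = h * \<epsilon> * norm (a' t, b' t)" using h \<epsilon> by (simp del: scaleR_Pair)
    also have "\<dots> \<le> h * \<epsilon> * (norm (a' t) + norm (b' t))"
      using h \<epsilon> by (intro mult_left_mono norm_Pair_le) auto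
    finally have "c * h < h * \<epsilon> * (norm (a' t) + norm (b' t))" using \<xi>[OF t] by simp
    then have "h * c < h * (\<epsilon> * (norm (a' t) + norm (b' t)))" by (simp only: mult_ac)
    then have "c < \<epsilon> * (norm (a' t) + norm (b' t))" using h(1) by (simp only: mult_less_cancel_left_pos)
    then have "2 * k < norm (a' t) + norm (b' t)"
      using \<epsilon> by (simp add: k_def pos_divide_less_eq mult.commute)
    then show "t \<in> E1 \<union> E2" using t by (auto simp: E1_def E2_def)
  qed
  \<comment> \<open>More than \<alpha>/2 is covered by two sets, so one of them carries at least
    \<alpha>/4, and the corresponding correction has seminorm at least \<open>k * \<beta>\<close>,
    that is 2.\<close>
  then have "measure M E \<le> measure M (E1 \<union> E2)"
    using E12 E12_sub fin_sub[of "E1 \<union> E2"] unfolding measure_def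
    by (intro enn2real_mono emeasure_mono_AE) auto
  also have "\<dots> \<le> measure M E1 + measure M E2"
    by (rule measure_Un_le) (use E12 in auto)
  finally have "\<alpha> / 4 \<le> measure M E1 \<or> \<alpha> / 4 \<le> measure M E2" using \<alpha>E by linarith
  then have "\<beta> \<le> min 1 (measure M E1) \<or> \<beta> \<le> min 1 (measure M E2)" by (auto simp: \<beta>_def)
  then have "k * \<beta> \<le> k * min 1 (measure M E1) \<or> k * \<beta> \<le> k * min 1 (measure M E2)"
    using k(1) mult_left_mono by blast
  moreover have "k * min 1 (measure M E1) \<le> Lp_seminorm p M a'"
    by (rule Lp_seminorm_lower_bound[OF p a' E12(1) fin_sub[OF E12_sub(1)] k(1)]) (simp add: E1_def)
  moreover have "k * min 1 (measure M E2) \<le> Lp_seminorm r M b'"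
    by (rule Lp_seminorm_lower_bound[OF r b' E12(2) fin_sub[OF E12_sub(2)] k(1)]) (simp add: E2_def)
  moreover have "0 \<le> Lp_seminorm p M a'" "0 \<le> Lp_seminorm r M b'" by (auto simp: Lp_seminorm_def)
  ultimately show False using ab' k(2) by linarith
qed

theorem theorem3:
  fixes p r :: ennreal
    and M :: "'a measure"
    and S :: "'a \<Rightarrow> ('y::{banach, second_countable_topology} \<times> 'z::{banach, second_countable_topology}) set"
    and x :: "'a \<Rightarrow> 'y" and y :: "'a \<Rightarrow> 'z"
  assumes "1 \<le> p" and "1 \<le> r"
    and "sigma_finite_measure M" and "complete_measure M"
    and "measurable_multifunction M S"
    and "\<forall>t\<in>space M. S t \<noteq> {} \<and> closed (S t)"
    and "x \<in> Lp_fun p M" and "y \<in> Lp_fun r M"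
    and "(Lp_class p M x, Lp_class r M y) \<in> Sel p r M S"
  shows "clarke_cone (sum_space (Lp_space p M) (Lp_space r M)) (Sel p r M S)
           (Lp_class p M x, Lp_class r M y)
         \<subseteq> {(Lp_class p M u, Lp_class r M v) | u v.
              u \<in> Lp_fun p M \<and> v \<in> Lp_fun r M \<and>
              (AE t in M. (u t, v t) \<in> clarke_cone (sum_space type_space type_space) (S t) (x t, y t))}"
proof
  fix w assume w: "w \<in> clarke_cone (sum_space (Lp_space p M) (Lp_space r M)) (Sel p r M S)
    (Lp_class p M x, Lp_class r M y)"
  then have "w \<in> points (Lp_space p M) \<times> points (Lp_space r M)"
    by (simp add: clarke_cone_def sum_space_def)
  then obtain u v where u: "u \<in> Lp_fun p M" and v: "v \<in> Lp_fun r M"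
    and w_eq: "w = (Lp_class p M u, Lp_class r M v)"
    by (auto simp: points_Lp_space)
  have ne: "S t \<noteq> {}" and cl: "closed (S t)" if "t \<in> space M" for t using assms(6) that by auto
  have xyS: "AE t in M. (x t, y t) \<in> S t"
    using assms(9) Sel_iff[OF assms(7,8)] by blast
  have [measurable]: "x \<in> borel_measurable M" "y \<in> borel_measurable M"
      "u \<in> borel_measurable M" "v \<in> borel_measurable M"
    using assms(7,8) u v by (auto simp: Lp_fun_def)
  interpret sigma_finite_measure M by (rule assms(3))
  \<comment> \<open>Cuts the space into countably many pieces of finite measure, as
    \<open>null_of_eventually_escapes\<close> requires.\<close>
  obtain A :: "nat \<Rightarrow> 'a set" where A: "range A \<subseteq> sets M" "(\<Union>i. A i) = space M" "\<And>i. emeasure M (A i) \<noteq> \<infinity>"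
    using sigma_finite by metis
  let ?esc = "\<lambda>k n m t. escapes (S t) (x t, y t) (u t, v t) (1 / real (Suc k)) (1 / real (Suc n)) (1 / real (Suc m))"
  have [measurable]: "Measurable.pred M (?esc k n m)" for k n m
    by (rule escapes_measurable_selection(1)[OF assms(5) ne cl]) auto
  \<comment> \<open>Rates and radii run through reciprocals of positive integers, so only countable
    quantifiers occur and the sets are measurable.\<close>
  define N where "N k i = {t \<in> space M. \<forall>n. \<exists>m0. \<forall>m\<ge>m0. ?esc k n m t} \<inter> A i" for k i
  have "N k i \<in> null_sets M" for k i
  proof (rule null_setsI)
    have Ai: "A i \<in> sets M" using A(1) by blast
    then show N_sets: "N k i \<in> sets M" unfolding N_def by measurable
    show "emeasure M (N k i) = 0"
    proof (rule null_of_eventually_escapes[OF assms(1,2,5) ne cl assms(7,8) xyS u v w[unfolded w_eq] _ N_sets])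
      show "emeasure M (N k i) < \<infinity>"
        using emeasure_mono[of "N k i" "A i" M] Ai A(3)[of i] by (auto simp: N_def top_unique less_top)
      fix t and \<rho> :: real assume t: "t \<in> N k i" and \<rho>: "0 < \<rho>"
      \<comment> \<open>An escape within the smaller radius \<open>1 / real (Suc n)\<close> is also
        one within \<rho>.\<close>
      obtain n where n: "1 / real (Suc n) < \<rho>"
        using eventually_inverse_Suc_less[OF \<rho>] by (auto simp: eventually_sequentially)
      have "\<forall>\<^sub>F m in sequentially. ?esc k n m t"
        using t by (auto simp: N_def eventually_sequentially)
      then show "\<forall>\<^sub>F m in sequentially. escapes (S t) (x t, y t) (u t, v t) (1 / real (Suc k)) \<rho> (1 / real (Suc m))"
        by eventually_elim (erule escapes_mono; use n in simp)
    next
      show "0 < 1 / real (Suc k)" by simp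
    qed
  qed
  then have "AE t in M. \<forall>k i. t \<notin> N k i"
    by (simp add: AE_all_countable AE_not_in)
  then have "AE t in M. (u t, v t) \<in> clarke_cone (sum_space type_space type_space) (S t) (x t, y t)"
  proof (rule AE_mp, intro AE_I2 impI)
    fix t assume t: "t \<in> space M" and notN: "\<forall>k i. t \<notin> N k i"
    show "(u t, v t) \<in> clarke_cone (sum_space type_space type_space) (S t) (x t, y t)"
    proof (rule ccontr)
      assume "(u t, v t) \<notin> clarke_cone (sum_space type_space type_space) (S t) (x t, y t)"
      \<comment> \<open>A point where the cone condition fails thus falls into one of the countably
        many null sets.\<close>
      then obtain k where k: "\<And>\<rho>. 0 < \<rho> \<Longrightarrow>
          \<forall>\<^sub>F m in sequentially. escapes (S t) (x t, y t) (u t, v t) (1 / real (Suc k)) \<rho> (1 / real (Suc m))"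
        by (rule not_clarke_cone_escapes) blast
      have "\<forall>\<^sub>F m in sequentially. ?esc k n m t" for n by (rule k) simp
      moreover obtain i where "t \<in> A i" using t A(2) by blast
      ultimately have "t \<in> N k i" using t by (simp add: N_def eventually_sequentially)
      then show False using notN by blast
    qed
  qed
  then show "w \<in> {(Lp_class p M u, Lp_class r M v) | u v. u \<in> Lp_fun p M \<and> v \<in> Lp_fun r M \<and>
      (AE t in M. (u t, v t) \<in> clarke_cone (sum_space type_space type_space) (S t) (x t, y t))}"
    using w_eq u v by blast
qed

end
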